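(* Let $k\ge1$ be a fixed integer and assume the following conjecture: whenever $\mathfrak S(\{0\}\cup D_k)\ne0$, $$G_k(x,D_k)=\mathfrak S(\{0\}\cup D_k)\,Li_{k+1}(x,D_k)+E(x,D_k),\qquad Li_{k+1}(x,D_k)=\int_2^{x-d_k}\frac{dt}{\log^{k+1}t},$$ where $E(x,D_k)=o\big(x/\log^{k+3}x\big)$ as $x\to\infty$, uniformly over all sets $D_k$ with $\mathfrak S(\{0\}\cup D_k)\neq 0$ and $D_k\subset\Big[2,\frac{2^{k+1}(k+1)!}{2^{k+1}(k+1)!+1}x\Big]$. For $x$ large enough, let $D_k^*$ be a $k$-tuple prime difference champion for the primes $\le x$ and $d^*$ the greatest common divisor of its elements. Then: (i) there is a constant $C_k>0$ depending only on $k$ such that, for all sufficiently large $x$, every prime $p\le C_k\log\log x$ divides $d^*$; (ii) for all sufficiently large $x$, $d^*$ is square-free.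
   Context: For a set $D_k=\{d_1,\dots,d_k\}$ of $k$ distinct integers with $d_1<\dots<d_k$ and real $x$, $G_k(x,D_k)=\#\{p\le x-d_k:\ p,\ p+d_1,\dots,p+d_k \text{ all prime}\}$. $D_k^*$ is a $k$-tuple prime difference champion for primes $\le x$ if $G_k(x,D_k^* )=\max_{D_k}G_k(x,D_k)$ over all sets $D_k$ of $k$ distinct integers. For a finite set $A$ of $m$ distinct integers, the singular series is $\mathfrak S(A)=\prod_p\big(1-\frac1p\big)^{-m}\big(1-\frac{v_A(p)}{p}\big)$, the product over all primes, where $v_A(p)$ is the number of distinct residue classes modulo $p$ occupied by the elements of $A$. Here $\{0\}\cup D_k$ has $k+1$ elements. *)

theory Defs
  imports "HOL-Analysis.Analysis" "HOL-Computational_Algebra.Computational_Algebra"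
begin

text \<open>The differences are taken to be positive: \<open>p\<close> is the smallest and \<open>p + d\<^sub>k \<le> x\<close> the
  largest prime of the tuple. (With \<open>0\<close> allowed, \<open>{0} \<union> D\<close> would not have \<open>k + 1\<close> elements;
  with negative differences, \<open>p \<le> x - d\<^sub>k\<close> would not bound the tuple by \<open>x\<close>.)\<close>

definition difference_set :: "nat \<Rightarrow> int set \<Rightarrow> bool" where
  "difference_set k D \<longleftrightarrow> finite D \<and> card D = k \<and> (\<forall>d\<in>D. 0 < d)"

definition tuple_count :: "real \<Rightarrow> int set \<Rightarrow> nat" where
  "tuple_count x D =
     card {p::int. prime p \<and> real_of_int p \<le> x - real_of_int (Max D) \<and> (\<forall>d\<in>D. prime (p + d))}"

definition difference_champion :: "nat \<Rightarrow> real \<Rightarrow> int set \<Rightarrow> bool" where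
  "difference_champion k x D \<longleftrightarrow>
     difference_set k D \<and> (\<forall>D'. difference_set k D' \<longrightarrow> tuple_count x D' \<le> tuple_count x D)"

definition residue_count :: "int set \<Rightarrow> nat \<Rightarrow> nat" where
  "residue_count A p = card ((\<lambda>a. a mod int p) ` A)"

text \<open>All but finitely many factors are nonzero and of the form \<open>1 + O(1/p\<^sup>2)\<close>, so the product
  converges in the sense of \<^const>\<open>convergent_prod\<close>; \<^const>\<open>prodinf\<close> is \<open>0\<close> exactly when some
  factor vanishes.\<close>

definition singular_series :: "int set \<Rightarrow> real" where
  "singular_series A =
     (\<Prod>p. if prime p
           then (1 - real (residue_count A p) / real p) / (1 - 1 / real p) ^ card A
           else 1)"

definition Li_tuple :: "nat \<Rightarrow> real \<Rightarrow> int set \<Rightarrow> real" where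
  "Li_tuple m x D = integral {2..x - real_of_int (Max D)} (\<lambda>t. 1 / ln t ^ m)"

definition tuple_error :: "nat \<Rightarrow> real \<Rightarrow> int set \<Rightarrow> real" where
  "tuple_error k x D =
     real (tuple_count x D) - singular_series ({0} \<union> D) * Li_tuple (k + 1) x D"

definition range_factor :: "nat \<Rightarrow> real" where
  "range_factor k = 2 ^ (k + 1) * fact (k + 1) / (2 ^ (k + 1) * fact (k + 1) + 1)"

definition uniform_tuple_conjecture :: "nat \<Rightarrow> bool" where
  "uniform_tuple_conjecture k \<longleftrightarrow>
     (\<forall>\<epsilon>>0. \<forall>\<^sub>F x in at_top. \<forall>D.
        difference_set k D \<and> singular_series ({0} \<union> D) \<noteq> 0 \<and>
        (\<forall>d\<in>D. 2 \<le> real_of_int d \<and> real_of_int d \<le> range_factor k * x)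
        \<longrightarrow> \<bar>tuple_error k x D\<bar> \<le> \<epsilon> * (x / ln x ^ (k + 3)))"

end

theory Submission imports Defs "HOL-Real_Asymp.Real_Asymp" begin

text \<open>The singular series of \<open>{0} \<union> D\<close> is largest when many small primes divide all elements of \<open>D\<close>.
  Taking \<open>D = {P, 2P, \<dots>, kP}\<close> with \<open>P \<le> sqrt x\<close> the primorial of about \<open>(ln x) / 6\<close> gives a competitor
  whose singular series is within a factor \<open>1 + O(1 / ln (ln x))\<close> of the maximum, while a prime \<open>p\<close>
  not dividing all of \<open>D\<close> costs a factor \<open>1 - 1 / p\<close>; so a champion cannot miss a prime
  \<open>p \<le> C ln (ln x)\<close> for small \<open>C\<close>.

  For square-freeness, some prime \<open>q = O(ln x)\<close> misses the gcd of a champion \<open>D\<close>, and comparison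
  with \<open>q D\<close>, whose singular series is larger by a factor at least \<open>1 + 1 / q\<close>, forces
  \<open>Max D\<close> to be at least of order \<open>x / ln\<^sup>2 x\<close>.
  If \<open>p\<^sup>2\<close> divided the gcd, then \<open>D / p\<close> would have the same singular series but a longer range of
  integration; the error term \<open>o(x / ln ^ (k + 3) x)\<close> is too small to compensate the gain.

  Differences beyond the range of the conjecture need no sieve bound: the count is monotone
  in \<open>x\<close>, so the conjecture can be applied at a slightly larger \<open>x\<close>.\<close>

section \<open>Primorials\<close>

definition primorial :: "nat \<Rightarrow> nat" where
  "primorial n = \<Prod>{p. prime p \<and> p \<le> n}"

lemma finite_primes_le [simp]: "finite {p::nat. prime p \<and> p \<le> n}"
  by (rule finite_subset[of _ "{..n}"]) auto

lemma primorial_pos: "primorial n > 0"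
  unfolding primorial_def by (intro prod_pos) (auto dest: prime_gt_0_nat)

lemma prod_primes_dvd:
  fixes g :: nat
  assumes "finite F" "\<And>p. p \<in> F \<Longrightarrow> prime p" "\<And>p. p \<in> F \<Longrightarrow> p dvd g"
  shows "\<Prod>F dvd g"
  using assms
proof (induction F rule: finite_induct)
  case (insert p F)
  have "coprime p (\<Prod>F)"
    using insert by (intro prod_coprime_right) (auto intro!: primes_coprime)
  then show ?case using insert by (auto intro: divides_mult)
qed auto

lemma primorial_dvd_iff:
  fixes g :: nat
  shows "primorial n dvd g \<longleftrightarrow> (\<forall>p. prime p \<and> p \<le> n \<longrightarrow> p dvd g)"
proof
  assume "primorial n dvd g"
  moreover have "p dvd primorial n" if "prime p" "p \<le> n" for p
    unfolding primorial_def using that by (intro dvd_prodI) auto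
  ultimately show "\<forall>p. prime p \<and> p \<le> n \<longrightarrow> p dvd g" using dvd_trans by blast
next
  assume *: "\<forall>p. prime p \<and> p \<le> n \<longrightarrow> p dvd g"
  show "primorial n dvd g" unfolding primorial_def using * by (intro prod_primes_dvd) auto
qed

lemma primorial_mono: "m \<le> n \<Longrightarrow> primorial m \<le> primorial n"
  using primorial_dvd_iff[of m "primorial n"] primorial_dvd_iff[of n "primorial n"] primorial_pos[of n]
  by (intro dvd_imp_le) auto

text \<open>The primes in \<open>(h, 2h]\<close> all divide the central binomial coefficient.\<close>

lemma primorial_double: "primorial (2 * h) \<le> primorial h * 4 ^ h"
proof -
  let ?Q = "{p. prime p \<and> p \<le> h}" and ?R = "{p. prime p \<and> h < p \<and> p \<le> 2 * h}"
  have finR: "finite ?R" by (rule finite_subset[of _ "{..2*h}"]) auto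
  have "\<Prod>?R dvd (2*h choose h)"
  proof (rule prod_primes_dvd[OF finR])
    fix p assume "p \<in> ?R"
    then have p: "prime p" "h < p" "p \<le> 2 * h" by auto
    have "p dvd fact (2 * h)" using p by (simp add: prime_dvd_fact_iff)
    moreover have "fact (2 * h) = fact h * fact h * ((2*h) choose h)"
      using binomial_fact_lemma[of h "2*h"] by (simp add: mult_2)
    moreover have "\<not> p dvd fact h" using p by (simp add: prime_dvd_fact_iff)
    ultimately show "p dvd (2*h choose h)" using p(1) by (simp add: prime_dvd_mult_iff)
  qed auto
  then have "\<Prod>?R \<le> (2*h choose h)" by (intro dvd_imp_le) auto
  also have "\<dots> \<le> 2 ^ (2 * h)" by (rule binomial_le_pow2)
  finally have R: "\<Prod>?R \<le> 4 ^ h" by (simp add: power_mult)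
  have "{p. prime p \<and> p \<le> 2 * h} = ?Q \<union> ?R" by auto
  then have "primorial (2 * h) = \<Prod>?Q * \<Prod>?R"
    unfolding primorial_def using finR by (simp only:) (subst prod.union_disjoint, auto)
  then show ?thesis using R by (simp add: primorial_def)
qed

text \<open>Strong induction by halving with rounding up: for n \<ge> 3 the number h = ceil(n/2)
  satisfies 3 h \<le> 2 n, so the factor \<open>4 ^ h\<close> gained in passing from h to 2 h is
  absorbed when the base is 16.\<close>

lemma primorial_le: "primorial n \<le> 16 ^ n"
proof (induction n rule: less_induct)
  case (less n)
  show ?case
  proof (cases "n < 3")
    case True
    have "primorial n \<le> 2 ^ n"
    proof (cases "n = 2")
      case True
      have "{p::nat. prime p \<and> p \<le> 2} = {2}" by (auto dest: prime_ge_2_nat)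
      then show ?thesis using True by (simp add: primorial_def)
    next
      case False
      then have *: "{p. prime p \<and> p \<le> n} = {}" using \<open>n < 3\<close> by (auto dest: prime_ge_2_nat)
      show ?thesis unfolding primorial_def * by simp
    qed
    also have "\<dots> \<le> 16 ^ n" by (intro power_mono) auto
    finally show ?thesis .
  next
    case False
    define h where "h = (n + 1) div 2"
    have h: "h < n" "n \<le> 2 * h" "3 * h \<le> 2 * n" using False by (auto simp: h_def)
    have "primorial n \<le> primorial (2 * h)" by (rule primorial_mono[OF h(2)])
    also have "\<dots> \<le> primorial h * 4 ^ h" by (rule primorial_double)
    also have "\<dots> \<le> 16 ^ h * 4 ^ h" using less h by (intro mult_right_mono) auto
    also have "\<dots> = 4 ^ (3 * h)" 
      by (simp add: power_mult power_mult_distrib[symmetric])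
    also have "\<dots> \<le> 4 ^ (2 * n)" using h by (intro power_increasing) auto
    also have "\<dots> = 16 ^ n" by (simp add: power_mult)
    finally show ?thesis .
  qed
qed

text \<open>Leibniz's harmonic triangle: \<open>1 / (m (n choose m))\<close> is a signed sum of reciprocals of \<open>1, \<dots>, n\<close>.\<close>

lemma common_multiple_Leibniz_triangle:
  fixes N :: nat
  assumes "\<And>j. 1 \<le> j \<Longrightarrow> j \<le> n \<Longrightarrow> j dvd N" "1 \<le> m" "m \<le> n"
  shows "m * (n choose m) dvd N"
proof -
  \<comment> \<open>Integrality of the quotient, unlike divisibility in \<nat>, passes directly to
    the difference of two quotients; one of them belongs to a smaller row, so \<open>n\<close> stays
    arbitrary in the induction on \<open>m\<close>.\<close>
  have "\<exists>z::int. real N / (real m * real (n choose m)) = of_int z"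
    if "1 \<le> m" "m \<le> n" "\<And>j. 1 \<le> j \<Longrightarrow> j \<le> n \<Longrightarrow> j dvd N" for m n
    using that
  proof (induction m arbitrary: n rule: nat_induct_at_least)
    case base
    then obtain z where "N = n * z" by (meson dvdE order_refl)
    then show ?case using base by (intro exI[of _ "int z"]) auto
  next
    case (Suc m)
    then obtain n' where n: "n = Suc n'" "m \<le> n'" by (cases n) auto
    obtain z1 :: int where z1: "real N / (real m * real (n' choose m)) = z1"
      using Suc.IH[of n'] Suc.prems n by auto
    obtain z2 :: int where z2: "real N / (real m * real (n choose m)) = z2"
      using Suc.IH[of n] Suc.prems by auto
    define a where "a = real (n' choose m)"
    have a: "a > 0" using n by (simp add: a_def)
    have m: "m \<ge> 1" by fact
    have 1: "real (Suc m) * real (n choose Suc m) = real n * a"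
      unfolding a_def n of_nat_mult[symmetric] using Suc_times_binomial_eq[of n' m] by simp
    have "(Suc n' - m) * (Suc n' choose m) = Suc n' * (n' choose m)"
      using n binomial_absorb_comp[of "Suc n'" m] by simp
    then have "real (Suc n' - m) * real (Suc n' choose m) = real (Suc n') * a"
      unfolding a_def of_nat_mult[symmetric] by simp
    then have 2: "real (n choose m) = real n * a / (real n - real m)"
      using n by (simp add: of_nat_diff field_simps)
    have nm: "real n > real m" using n by simp
    \<comment> \<open>The recurrence of the triangle, 1/((m+1) C(n,m+1)) = 1/(m C(n-1,m)) - 1/(m
      C(n,m)), with the left denominator written as n C(n-1,m).\<close>
    have "real N / (real n * a) = real N / (real m * a) - real N / (real m * real (n choose m))"
      unfolding 2 using a m nm by (simp add: field_simps)
    also have "\<dots> = of_int (z1 - z2)" using z1 z2 by (simp add: a_def)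
    finally show ?case unfolding 1 by blast
  qed
  then obtain z :: int where z: "real N / (real m * real (n choose m)) = of_int z"
    using assms by blast
  have pos: "real m * real (n choose m) > 0" using assms by auto
  have "real N = of_int z * (real m * real (n choose m))"
    using z pos by (metis less_irrefl nonzero_divide_eq_eq)
  then have "real N = real (m * (n choose m)) * of_int z" by (simp add: mult_ac)
  then have "of_int (int N) = (of_int (int (m * (n choose m)) * z) :: real)" by simp
  then have "int N = int (m * (n choose m)) * z" by (simp only: of_int_eq_iff)
  then have "int (m * (n choose m)) dvd int N" by (rule dvdI)
  then show ?thesis by (simp only: int_dvd_int_iff)
qed

text \<open>A prime above s has square above n, so it occurs at most once in lcm(1,...,n); each of
  the at most s other primes contributes a power of size at most n. Since the Leibniz entry divides
  the lcm, a large binomial coefficient forces a large primorial.\<close>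

lemma Leibniz_le_power_primorial:
  assumes "n < (s + 1) ^ 2" "1 \<le> m" "m \<le> n"
  shows "m * (n choose m) \<le> n ^ s * primorial n"
proof -
  have n: "n \<ge> 1" using assms by simp
  \<comment> \<open>For prime p this is the exponent of p in lcm(1,...,n), so \<open>N\<close> below
    is that lcm.\<close>
  define e where "e p = Max ((\<lambda>j. multiplicity p j) ` {1..n})" for p :: nat
  let ?Q = "{p::nat. prime p \<and> p \<le> n}"
  define N where "N = (\<Prod>p\<in>?Q. p ^ e p)"
  have N: "N > 0" unfolding N_def by (intro prod_pos) (auto dest: prime_gt_0_nat)
  have e_le: "p ^ e p \<le> n" if "prime p" for p
  proof -
    have "e p \<in> (\<lambda>j. multiplicity p j) ` {1..n}" unfolding e_def using n by (intro Max_in) auto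
    then obtain j where j: "j \<in> {1..n}" "e p = multiplicity p j" by auto
    then have "p ^ e p \<le> j" by (auto intro: dvd_imp_le multiplicity_dvd)
    then show ?thesis using j by simp
  qed
  have "j dvd N" if "1 \<le> j" "j \<le> n" for j
  proof (rule multiplicity_le_imp_dvd)
    fix p :: nat assume p: "prime p"
    have "multiplicity p j \<le> e p" unfolding e_def using that by (intro Max_ge) auto
    moreover have "multiplicity p j = 0" if "\<not> p \<le> n"
      using that \<open>1 \<le> j\<close> \<open>j \<le> n\<close> by (intro not_dvd_imp_multiplicity_0) (auto dest: dvd_imp_le)
    moreover have "multiplicity p N = (if p \<in> ?Q then e p else 0)"
      unfolding N_def using p by (intro multiplicity_prod_prime_powers) auto
    ultimately show "multiplicity p j \<le> multiplicity p N" using p by auto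
  qed (use that in auto)
  then have "m * (n choose m) dvd N" using assms by (intro common_multiple_Leibniz_triangle) auto
  then have "m * (n choose m) \<le> N" using N by (intro dvd_imp_le) auto
  also have "N \<le> (\<Prod>p\<in>?Q. (if p \<le> s then n else 1) * p)"
    unfolding N_def
  proof (intro prod_mono conjI)
    fix p assume "p \<in> ?Q"
    then have p: "prime p" "p \<le> n" by auto
    show "p ^ e p \<le> (if p \<le> s then n else 1) * p"
    proof (cases "p \<le> s")
      case True
      then show ?thesis using e_le[OF p(1)] prime_gt_0_nat[OF p(1)]
        by (auto intro: order_trans)
    next
      case False
      then have "(s + 1) ^ 2 \<le> p ^ 2" by (intro power_mono) auto
      then have "n < p ^ 2" using assms(1) by linarith
      then have "p ^ e p < p ^ 2" using e_le[OF p(1)] by simp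
      then have "e p < 2" using power_less_imp_less_exp[OF prime_gt_1_nat[OF p(1)]] by blast
      then have "p ^ e p \<le> p ^ 1" using p prime_gt_0_nat by (intro power_increasing) (auto simp: Suc_le_eq)
      then show ?thesis using False by simp
    qed
  qed auto
  also have "\<dots> = (\<Prod>p\<in>?Q. (if p \<le> s then n else 1)) * primorial n"
    by (simp add: prod.distrib primorial_def)
  also have "(\<Prod>p\<in>?Q. (if p \<le> s then n else 1)) = n ^ card {p \<in> ?Q. p \<le> s}"
    by (simp add: prod.If_cases Int_def)
  also have "\<dots> \<le> n ^ s"
  proof (intro power_increasing n)
    have "card {p \<in> ?Q. p \<le> s} \<le> card {1..s}"
      by (intro card_mono) (auto simp: Suc_le_eq prime_gt_0_nat)
    then show "card {p \<in> ?Q. p \<le> s} \<le> s" by simp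
  qed
  finally show ?thesis by simp
qed

text \<open>Chebyshev's lower bound. The entry m C(2m,m) is at least 4^m / 2, while the excess of
  the lcm over the primorial, at most (2m)^sqrt(2m), is eventually below 2^m / 2; a factor 2^m
  remains.\<close>

lemma primorial_ge: "\<forall>\<^sub>F m in at_top. 2 ^ m \<le> primorial (2 * m)"
proof -
  have "\<forall>\<^sub>F m::nat in at_top. 2 * (2 * real m) powr sqrt (2 * real m) \<le> 2 powr real m"
    by real_asymp
  moreover have "\<forall>\<^sub>F m::nat in at_top. m \<ge> 1" by (rule eventually_ge_at_top)
  ultimately show ?thesis
  proof eventually_elim
    case (elim m)
    define s where "s = nat \<lfloor>sqrt (real (2 * m))\<rfloor>"
    have s: "real s \<le> sqrt (2 * real m)" "sqrt (2 * real m) < real s + 1"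
      unfolding s_def by (simp_all)
    have "sqrt (2 * real m) ^ 2 < (real s + 1) ^ 2"
      using s(2) by (intro power_strict_mono) auto
    then have "real (2 * m) < real ((s + 1) ^ 2)" by (simp add: add.commute)
    then have "2 * m < (s + 1) ^ 2" by (simp only: of_nat_less_iff)
    then have "m * (2 * m choose m) \<le> (2 * m) ^ s * primorial (2 * m)"
      using elim by (intro Leibniz_le_power_primorial) auto
    then have "real (m * (2 * m choose m)) \<le> real ((2 * m) ^ s * primorial (2 * m))"
      by (simp only: of_nat_le_iff)
    then have 1: "real m * real (2 * m choose m) \<le> (2 * real m) ^ s * real (primorial (2 * m))"
      by simp
    have "4 ^ m / 2 = real m * (4 ^ m / (2 * real m))" using elim by simp
    also have "\<dots> \<le> real m * real (2 * m choose m)"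
      using central_binomial_lower_bound[of m] elim by (intro mult_left_mono) auto
    also note 1
    also have "(2 * real m) ^ s = (2 * real m) powr real s"
      using elim by (simp add: powr_realpow)
    also have "\<dots> * real (primorial (2 * m)) \<le> (2 powr real m / 2) * real (primorial (2 * m))"
    proof (intro mult_right_mono)
      have "(2 * real m) powr real s \<le> (2 * real m) powr sqrt (2 * real m)"
        using s elim by (intro powr_mono) auto
      then show "(2 * real m) powr real s \<le> 2 powr real m / 2" using elim(1) by linarith
    qed auto
    finally have "4 ^ m \<le> (2::real) ^ m * real (primorial (2 * m))"
      by (simp add: powr_realpow)
    moreover have "(4::real) ^ m = 2 ^ m * 2 ^ m" by (simp flip: power_mult_distrib)
    ultimately have "(2::real) ^ m * 2 ^ m \<le> 2 ^ m * real (primorial (2 * m))" by linarith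
    then have "(2::real) ^ m \<le> real (primorial (2 * m))" by (simp only: mult_le_cancel_left_pos zero_less_power zero_less_numeral)
    then have "real (2 ^ m) \<le> real (primorial (2 * m))" by simp
    then show ?case by (simp only: of_nat_le_iff)
  qed
qed

text \<open>If every prime up to 2m divided g, so would their primorial, forcing g \<ge> 2^m; m is
  chosen with 2^m > x.\<close>

lemma small_nondivisor_prime:
  "\<forall>\<^sub>F x in at_top. \<forall>g::nat. 0 < g \<and> real g \<le> x \<longrightarrow>
     (\<exists>q. prime q \<and> real q \<le> 4 * ln x \<and> \<not> q dvd g)"
proof -
  obtain m0 where m0: "\<And>m. m \<ge> m0 \<Longrightarrow> 2 ^ m \<le> primorial (2 * m)"
    using primorial_ge by (auto simp: eventually_at_top_linorder)
  have "\<forall>\<^sub>F x::real in at_top. real m0 \<le> ln x / ln 2" by real_asymp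
  moreover have "\<forall>\<^sub>F x::real in at_top. 4 \<le> ln x" by real_asymp
  moreover have "\<forall>\<^sub>F x::real in at_top. 1 < x" by (rule eventually_gt_at_top)
  ultimately show ?thesis
  proof eventually_elim
    case (elim x)
    \<comment> \<open>Just above log_2 x, so that 2^m > x; with ln 2 \<ge> 2/3 this still gives 2m
      \<le> 3 ln x + 2 \<le> 4 ln x.\<close>
    define m where "m = nat \<lfloor>ln x / ln 2\<rfloor> + 1"
    have nn: "ln x / ln 2 \<ge> 0" using elim by simp
    have m: "real m > ln x / ln 2" "real m \<le> ln x / ln 2 + 1" using nn unfolding m_def by (auto; linarith)+
    have "m \<ge> m0" using m elim by linarith
    have "ln x < real m * ln 2" using m by (simp add: field_simps)
    also have "\<dots> = ln (2 ^ m)" by (simp add: ln_realpow)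
    finally have x2: "x < 2 ^ m" using elim by (simp add: ln_less_cancel_iff)
    have "ln x / ln 2 \<le> ln x / (2/3)" using ln2_ge_two_thirds elim by (intro divide_left_mono) auto
    then have m4: "real (2 * m) \<le> 4 * ln x" using m elim by simp
    show ?case
    proof (intro allI impI)
      fix g :: nat assume g: "0 < g \<and> real g \<le> x"
      have "\<not> primorial (2 * m) dvd g"
      proof
        assume "primorial (2 * m) dvd g"
        then have "primorial (2 * m) \<le> g" using g by (intro dvd_imp_le) auto
        then have "2 ^ m \<le> g" using m0[OF \<open>m \<ge> m0\<close>] by simp
        then have "real (2 ^ m) \<le> real g" by (simp only: of_nat_le_iff)
        then have "2 ^ m \<le> real g" by simp
        then show False using g x2 by linarith
      qed
      then obtain q where "prime q" "q \<le> 2 * m" "\<not> q dvd g" by (auto simp: primorial_dvd_iff)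
      then show "\<exists>q. prime q \<and> real q \<le> 4 * ln x \<and> \<not> q dvd g"
        using m4 by (intro exI[of _ q]) auto
    qed
  qed
qed

section \<open>The singular series\<close>

lemma residue_count_le_card: "finite A \<Longrightarrow> residue_count A p \<le> card A"
  unfolding residue_count_def by (rule card_image_le)

lemma residue_count_pos: "finite A \<Longrightarrow> A \<noteq> {} \<Longrightarrow> residue_count A p \<ge> 1"
  unfolding residue_count_def by (simp add: Suc_le_eq card_gt_0_iff)

lemma residue_count_le:
  assumes "p > 0"
  shows "residue_count A p \<le> p"
proof -
  have "card ((\<lambda>a. a mod int p) ` A) \<le> card {0..<int p}"
    using assms by (intro card_mono) auto
  then show ?thesis by (simp add: residue_count_def)
qed

lemma residue_count_eq_card:
  assumes "\<And>a b. a \<in> A \<Longrightarrow> b \<in> A \<Longrightarrow> a \<noteq> b \<Longrightarrow> \<not> int p dvd a - b"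
  shows "residue_count A p = card A"
  unfolding residue_count_def
  by (rule card_image) (use assms in \<open>auto simp: inj_on_def mod_eq_dvd_iff\<close>)

lemma residue_count_eq_1:
  assumes "A \<noteq> {}" "\<And>a. a \<in> A \<Longrightarrow> int p dvd a"
  shows "residue_count A p = 1"
proof -
  have "(\<lambda>a. a mod int p) ` A = {0}" using assms by auto
  then show ?thesis by (simp add: residue_count_def)
qed

lemma residue_count_ge_2:
  assumes "finite A" "a \<in> A" "b \<in> A" "\<not> int p dvd a - b"
  shows "residue_count A p \<ge> 2"
proof -
  have "card {a mod int p, b mod int p} \<le> residue_count A p"
    unfolding residue_count_def using assms by (intro card_mono) auto
  moreover have "a mod int p \<noteq> b mod int p" using assms by (simp add: mod_eq_dvd_iff)
  ultimately show ?thesis by simp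
qed

lemma residue_count_scale:
  assumes "coprime (int p) c"
  shows "residue_count ((*) c ` A) p = residue_count A p"
proof -
  let ?g = "\<lambda>r. c * r mod int p"
  have "(\<lambda>a. a mod int p) ` (*) c ` A = ?g ` (\<lambda>a. a mod int p) ` A"
    by (simp add: image_image mod_mult_right_eq)
  moreover have "inj_on ?g ((\<lambda>a. a mod int p) ` A)"
  proof (rule inj_onI)
    fix r s
    assume rs: "r \<in> (\<lambda>a. a mod int p) ` A" "s \<in> (\<lambda>a. a mod int p) ` A" "?g r = ?g s"
    then have "int p dvd c * (r - s)" by (simp add: mod_eq_dvd_iff right_diff_distrib)
    then have "int p dvd r - s" using assms by (simp add: coprime_dvd_mult_right_iff)
    then have "r mod int p = s mod int p" by (simp add: mod_eq_dvd_iff)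
    then show "r = s" using rs by auto
  qed
  ultimately show ?thesis by (simp add: residue_count_def card_image)
qed

section \<open>Local factors of the singular series and their bounds\<close>

definition euler_factor :: "int set \<Rightarrow> nat \<Rightarrow> real" where
  "euler_factor A p =
     (if prime p then (1 - real (residue_count A p) / real p) / (1 - 1 / real p) ^ card A else 1)"

lemma singular_series_altdef: "singular_series A = prodinf (euler_factor A)"
  by (simp add: singular_series_def euler_factor_def[abs_def])

text \<open>The Euler factor at \<open>p\<close> of a set with \<open>k + 1\<close> elements that are all congruent modulo \<open>p\<close>.\<close>

definition aligned_factor :: "nat \<Rightarrow> nat \<Rightarrow> real" where
  "aligned_factor k p = (if prime p then (1 / (1 - 1 / real p)) ^ k else 1)"

lemma aligned_factor_ge_1: "aligned_factor k p \<ge> 1"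
proof (cases "prime p")
  case True
  then have "p > 1" by (rule prime_gt_1_nat)
  then have "1 \<le> (1 / (1 - 1 / real p)) ^ k" by (intro one_le_power) (simp add: field_simps)
  then show ?thesis by (simp add: aligned_factor_def)
qed (simp add: aligned_factor_def)

lemma euler_factor_nonneg: "euler_factor A p \<ge> 0"
proof (cases "prime p")
  case True
  then have "p > 1" by (rule prime_gt_1_nat)
  then show ?thesis using residue_count_le[of p A]
    by (auto simp: euler_factor_def intro!: divide_nonneg_nonneg)
qed (simp add: euler_factor_def)

lemma euler_factor_aligned:
  assumes "card A = k + 1" "residue_count A p = 1"
  shows "euler_factor A p = aligned_factor k p"
proof (cases "prime p")
  case True
  then have "p > 1" by (rule prime_gt_1_nat)
  then show ?thesis using True assms
    by (simp add: euler_factor_def aligned_factor_def power_one_over)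
qed (simp add: euler_factor_def aligned_factor_def)

lemma euler_factor_le_aligned:
  assumes "card A = k + 1"
  shows "euler_factor A p \<le> aligned_factor k p"
proof (cases "prime p")
  case True
  then have p: "p > 1" by (rule prime_gt_1_nat)
  have "A \<noteq> {}" "finite A" using assms by (auto intro: card_ge_0_finite)
  then have v: "residue_count A p \<ge> 1" by (intro residue_count_pos)
  have "euler_factor A p = (1 - real (residue_count A p) / real p) / (1 - 1 / real p) ^ (k + 1)"
    using True assms by (simp add: euler_factor_def)
  also have "\<dots> \<le> (1 - 1 / real p) / (1 - 1 / real p) ^ (k + 1)"
    using p v by (intro divide_right_mono diff_left_mono) auto
  also have "\<dots> = aligned_factor k p"
    using p True by (simp add: aligned_factor_def power_one_over)
  finally show ?thesis .
qed (simp add: euler_factor_def aligned_factor_def)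

text \<open>With at least two residue classes the numerator is at most 1 - 2/p \<le> (1 - 1/p)^2,
  against 1 - 1/p in the aligned case. This is the price of a prime that misses the gcd.\<close>

lemma euler_factor_le_nonaligned:
  assumes "card A = k + 1" "a \<in> A" "b \<in> A" "\<not> int p dvd a - b" "prime p"
  shows "euler_factor A p \<le> aligned_factor k p * (1 - 1 / real p)"
proof -
  have p: "p > 1" using assms by (intro prime_gt_1_nat)
  have "finite A" using assms by (auto intro: card_ge_0_finite)
  then have v: "residue_count A p \<ge> 2" using assms by (intro residue_count_ge_2)
  have "euler_factor A p = (1 - real (residue_count A p) / real p) / (1 - 1 / real p) ^ (k + 1)"
    using assms by (simp add: euler_factor_def)
  also have "\<dots> \<le> (1 - 1 / real p) ^ 2 / (1 - 1 / real p) ^ (k + 1)"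
  proof (intro divide_right_mono)
    have "real (residue_count A p) / real p \<ge> 2 / real p" using v p by (intro divide_right_mono) auto
    moreover have "1 - 2 / real p \<le> (1 - 1 / real p) ^ 2" by (simp add: power2_eq_square algebra_simps)
    ultimately show "1 - real (residue_count A p) / real p \<le> (1 - 1 / real p) ^ 2" by linarith
  qed (use p in auto)
  also have "\<dots> = aligned_factor k p * (1 - 1 / real p)"
    using p assms by (simp add: aligned_factor_def power_one_over power2_eq_square)
  finally show ?thesis .
qed

lemma euler_factor_le_1:
  assumes "finite A" "residue_count A p = card A"
  shows "euler_factor A p \<le> 1"
proof (cases "prime p")
  case True
  then have p: "p > 1" by (rule prime_gt_1_nat)
  have "1 + real (card A) * (- 1 / real p) \<le> (1 + (- 1 / real p)) ^ card A"
    using p by (intro Bernoulli_inequality) auto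
  then show ?thesis using True p assms by (simp add: euler_factor_def divide_le_eq_1)
qed (simp add: euler_factor_def)

text \<open>With m = card A, factor 1 - m^2/p^2 as (1 - m/p)(1 + m/p): the first factor is at most
  the numerator, and Bernoulli bounds the second by (1 + 1/p)^m \<le> (1 - 1/p)^(-m). For p < m the
  left side is not positive.\<close>

lemma euler_factor_ge:
  assumes "finite A"
  shows "1 - real (card A) ^ 2 / real p ^ 2 \<le> euler_factor A p"
proof (cases "prime p")
  case True
  then have p: "p > 1" by (rule prime_gt_1_nat)
  show ?thesis
  proof (cases "card A \<le> p")
    case False
    then have "real p ^ 2 \<le> real (card A) ^ 2" by (intro power_mono) auto
    then have "1 - real (card A) ^ 2 / real p ^ 2 \<le> 0" using p by simp
    then show ?thesis using euler_factor_nonneg[of A p] by linarith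
  next
    case c: True
    have "1 - real (card A) ^ 2 / real p ^ 2 = (1 - real (card A) / real p) * (1 + real (card A) / real p)"
      by (simp add: algebra_simps power2_eq_square)
    also have "\<dots> \<le> (1 - real (residue_count A p) / real p) * (1 / (1 - 1 / real p)) ^ card A"
    proof (intro mult_mono)
      show "1 - real (card A) / real p \<le> 1 - real (residue_count A p) / real p"
        using residue_count_le_card[OF assms, of p] p by (simp add: divide_right_mono)
      have "1 + real (card A) * (1 / real p) \<le> (1 + 1 / real p) ^ card A"
        by (intro Bernoulli_inequality) (auto intro: order_trans[of _ 0])
      also have "\<dots> \<le> (1 / (1 - 1 / real p)) ^ card A"
        using p by (intro power_mono) (auto simp: field_simps)
      finally show "1 + real (card A) / real p \<le> (1 / (1 - 1 / real p)) ^ card A" by simp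
      show "0 \<le> 1 - real (residue_count A p) / real p"
        using residue_count_le[of p A] p by simp
    qed auto
    also have "\<dots> = euler_factor A p" using True by (simp add: euler_factor_def power_one_over)
    finally show ?thesis .
  qed
qed (simp add: euler_factor_def)

text \<open>Primes beyond every difference of two elements separate the elements of A, so there the
  factor lies between 1 - m^2/p^2 and 1, and the deviations from 1 are summable.\<close>

lemma convergent_prod_euler_factor:
  assumes "finite A"
  shows "convergent_prod (euler_factor A)"
proof -
  \<comment> \<open>The inserted 0 keeps the maximum meaningful when A is empty.\<close>
  define N where "N = Max (insert 0 ((\<lambda>(a, b). nat \<bar>a - b\<bar>) ` (A \<times> A)))"
  have "norm (euler_factor A p - 1) \<le> real (card A) ^ 2 * inverse (real p ^ 2)" if "p > N" for p
  proof -
    have "residue_count A p = card A"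
    proof (rule residue_count_eq_card)
      fix a b assume ab: "a \<in> A" "b \<in> A" "a \<noteq> b"
      have "nat \<bar>a - b\<bar> \<le> N" unfolding N_def
        using ab assms by (intro Max_ge) (auto intro!: image_eqI[of _ _ "(a, b)"])
      then have "\<bar>a - b\<bar> < int p" using that by linarith
      then show "\<not> int p dvd a - b" using ab zdvd_imp_le[of "int p" "\<bar>a - b\<bar>"] by auto
    qed
    then have "euler_factor A p \<le> 1" using assms by (intro euler_factor_le_1)
    then show ?thesis using euler_factor_ge[OF assms, of p]
      by (simp add: divide_inverse)
  qed
  then have "\<forall>\<^sub>F p in sequentially. norm (norm (euler_factor A p - 1)) \<le> real (card A) ^ 2 * inverse (real p ^ 2)"
    by (intro eventually_sequentiallyI[of "Suc N"]) auto
  moreover have "summable (\<lambda>p. real (card A) ^ 2 * inverse (real p ^ 2))"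
    by (intro summable_mult inverse_power_summable) auto
  ultimately have "summable (\<lambda>p. norm (euler_factor A p - 1))"
    by (rule summable_comparison_test_ev)
  then show ?thesis
    by (intro abs_convergent_prod_imp_convergent_prod summable_imp_abs_convergent_prod)
qed

lemma singular_series_LIMSEQ:
  assumes "finite A"
  shows "(\<lambda>n. \<Prod>p\<le>n. euler_factor A p) \<longlonglongrightarrow> singular_series A"
  unfolding singular_series_altdef
  by (rule convergent_prod_LIMSEQ[OF convergent_prod_euler_factor[OF assms]])

text \<open>A convergent infinite product without zero factor is nonzero; conversely a zero factor
  makes all later partial products 0. A factor vanishes exactly when A meets every class modulo a
  prime.\<close>

lemma singular_series_eq_0_iff:
  assumes "finite A"
  shows "singular_series A = 0 \<longleftrightarrow> (\<exists>p. prime p \<and> residue_count A p = p)"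
proof
  assume "singular_series A = 0"
  then obtain p where p: "euler_factor A p = 0"
    using prodinf_nonzero[OF convergent_prod_euler_factor[OF assms]] by (auto simp: singular_series_altdef)
  then have "prime p" by (auto simp: euler_factor_def split: if_splits)
  moreover have "p > 1" using \<open>prime p\<close> by (rule prime_gt_1_nat)
  ultimately have "residue_count A p = p" using p by (auto simp: euler_factor_def)
  then show "\<exists>p. prime p \<and> residue_count A p = p" using \<open>prime p\<close> by blast
next
  assume "\<exists>p. prime p \<and> residue_count A p = p"
  then obtain p where p: "prime p" "residue_count A p = p" by blast
  then have "euler_factor A p = 0" by (auto simp: euler_factor_def)
  then have "\<forall>\<^sub>F n in sequentially. (\<Prod>p\<le>n. euler_factor A p) = 0"
    by (intro eventually_sequentiallyI[of p]) auto
  then have "(\<lambda>n. \<Prod>p\<le>n. euler_factor A p) \<longlonglongrightarrow> 0" by (simp add: tendsto_eventually)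
  then show "singular_series A = 0"
    using singular_series_LIMSEQ[OF assms] LIMSEQ_unique by blast
qed

lemma singular_series_nonneg: "finite A \<Longrightarrow> singular_series A \<ge> 0"
  by (rule LIMSEQ_le_const[OF singular_series_LIMSEQ]) (auto intro!: prod_nonneg euler_factor_nonneg)

section \<open>Effect of dilation by a prime on the singular series\<close>

lemma euler_factor_scale:
  assumes "prime q" "p \<noteq> q"
  shows "euler_factor ((*) (int q) ` A) p = euler_factor A p"
proof (cases "prime p")
  case True
  have "card ((*) (int q) ` A) = card A"
    using assms by (intro card_image) (auto simp: inj_on_def)
  moreover have "residue_count ((*) (int q) ` A) p = residue_count A p"
    using assms True by (intro residue_count_scale) (simp add: primes_coprime)
  ultimately show ?thesis by (simp add: euler_factor_def)
qed (simp add: euler_factor_def)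

text \<open>Dilation by q permutes the residues modulo every other prime, so only the factor at q
  changes: it becomes the aligned one, and A was short of it by at least 1 - 1/q. The comparison is
  made on partial products with n \<ge> q and passed to the limit.\<close>

lemma singular_series_scale_nonaligned:
  assumes "card A = k + 1" "a \<in> A" "b \<in> A" "\<not> int q dvd a - b" "prime q"
  shows "singular_series A \<le> (1 - 1 / real q) * singular_series ((*) (int q) ` A)"
proof -
  have fin: "finite A" using assms by (auto intro: card_ge_0_finite)
  have q: "q > 1" using assms by (intro prime_gt_1_nat)
  let ?B = "(*) (int q) ` A"
  have "card ?B = card A"
    using assms by (intro card_image) (auto simp: inj_on_def)
  moreover have "residue_count ?B q = 1" using assms by (intro residue_count_eq_1) auto
  ultimately have B: "euler_factor ?B q = aligned_factor k q"
    using assms by (intro euler_factor_aligned) auto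
  have "(\<Prod>p\<le>n. euler_factor A p) \<le> (1 - 1 / real q) * (\<Prod>p\<le>n. euler_factor ?B p)" if "n \<ge> q" for n
  proof -
    have "(\<Prod>p\<le>n. euler_factor A p) \<le> (\<Prod>p\<le>n. (if p = q then 1 - 1 / real q else 1) * euler_factor ?B p)"
    proof (intro prod_mono conjI euler_factor_nonneg)
      fix p
      show "euler_factor A p \<le> (if p = q then 1 - 1 / real q else 1) * euler_factor ?B p"
        using euler_factor_le_nonaligned[OF assms] B euler_factor_scale[OF assms(5), of p A]
        by (auto simp: mult.commute)
    qed
    also have "\<dots> = (1 - 1 / real q) * (\<Prod>p\<le>n. euler_factor ?B p)"
      using that by (simp add: prod.distrib prod.delta)
    finally show ?thesis .
  qed
  then have "\<exists>N. \<forall>n\<ge>N. (\<Prod>p\<le>n. euler_factor A p) \<le> (1 - 1 / real q) * (\<Prod>p\<le>n. euler_factor ?B p)"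
    by blast
  moreover have "(\<lambda>n. (1 - 1 / real q) * (\<Prod>p\<le>n. euler_factor ?B p)) \<longlonglongrightarrow> (1 - 1 / real q) * singular_series ?B"
    using fin by (intro tendsto_mult tendsto_const singular_series_LIMSEQ) auto
  ultimately show ?thesis using singular_series_LIMSEQ[OF fin] LIMSEQ_le by blast
qed

text \<open>If A is already aligned at q, the factor at q does not change either. This is what later
  allows a division of the champion by p when p^2 divides its gcd.\<close>

lemma singular_series_scale_aligned:
  assumes "A \<noteq> {}" "\<And>a. a \<in> A \<Longrightarrow> int q dvd a" "prime q"
  shows "singular_series ((*) (int q) ` A) = singular_series A"
proof -
  let ?B = "(*) (int q) ` A"
  have "card ?B = card A"
    using assms by (intro card_image) (auto simp: inj_on_def)
  moreover have "residue_count ?B q = 1" "residue_count A q = 1"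
    by (rule residue_count_eq_1; use assms in auto)+
  ultimately have "euler_factor ?B p = euler_factor A p" for p
    using euler_factor_scale[OF assms(3), of p A] by (cases "p = q") (auto simp: euler_factor_def)
  then have "euler_factor ?B = euler_factor A" by (rule ext)
  then show ?thesis by (simp add: singular_series_altdef)
qed

section \<open>Lower bound for the singular series of the competitor\<close>

lemma prod_atMost_split:
  fixes f :: "nat \<Rightarrow> real"
  assumes "m \<le> n"
  shows "(\<Prod>i\<le>n. f i) = (\<Prod>i\<le>m. f i) * (\<Prod>i\<in>{m<..n}. f i)"
proof -
  have "{..n} = {..m} \<union> {m<..n}" using assms by auto
  then show ?thesis by (simp only:) (subst prod.union_disjoint, auto)
qed

lemma sum_inverse_squares_le:
  assumes "1 \<le> y" "y \<le> n"
  shows "(\<Sum>i\<in>{y<..n}. 1 / real i ^ 2) \<le> 1 / real y - 1 / real n"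
  using assms(2)
proof (induction n rule: dec_induct)
  case (step n)
  have "{y<..Suc n} = insert (Suc n) {y<..n}" using step by auto
  then have "(\<Sum>i\<in>{y<..Suc n}. 1 / real i ^ 2) = 1 / real (Suc n) ^ 2 + (\<Sum>i\<in>{y<..n}. 1 / real i ^ 2)"
    by simp
  also have "\<dots> \<le> 1 / real (Suc n) ^ 2 + (1 / real y - 1 / real n)" using step by simp
  also have "1 / real (Suc n) ^ 2 \<le> 1 / real n - 1 / real (Suc n)"
  proof -
    have n: "real n > 0" using step assms by simp
    then have "1 / real n - 1 / real (Suc n) = 1 / (real n * real (Suc n))" by (simp add: field_simps)
    moreover have "1 / real (Suc n) ^ 2 \<le> 1 / (real n * real (Suc n))"
      using n by (intro divide_left_mono) (auto simp: power2_eq_square)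
    ultimately show ?thesis by simp
  qed
  finally show ?case by simp
qed simp

text \<open>Every prime up to y divides the primorial, so those factors are the largest possible.
  Beyond y each factor is at least 1 - (k+1)^2/p^2, and the Weierstrass inequality with the
  telescoping bound for the sum of 1/p^2 gives the correction. The condition k + 1 \<le> y keeps
  these terms in [0,1].\<close>

lemma singular_series_test_set_ge:
  assumes y: "k + 1 \<le> y"
  shows "singular_series ((*) (int (primorial y)) ` {0..int k})
           \<ge> (\<Prod>p\<le>y. aligned_factor k p) * (1 - real (k + 1) ^ 2 / real y)"
proof -
  define A where "A = (*) (int (primorial y)) ` {0..int k}"
  have "card A = card {0..int k}"
    unfolding A_def using primorial_pos[of y] by (intro card_image) (auto simp: inj_on_def)
  then have A: "card A = k + 1" "finite A" by (auto simp: A_def)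
  have al: "euler_factor A p = aligned_factor k p" if "p \<le> y" for p
  proof (cases "prime p")
    case True
    have "p dvd primorial y" using primorial_dvd_iff[of y "primorial y"] that True by simp
    then have "int p dvd int (primorial y)" by simp
    then have "residue_count A p = 1"
      by (intro residue_count_eq_1) (auto simp: A_def)
    then show ?thesis using A by (intro euler_factor_aligned)
  qed (simp add: euler_factor_def aligned_factor_def)
  have "(\<Prod>p\<le>y. aligned_factor k p) * (1 - real (k + 1) ^ 2 / real y) \<le> (\<Prod>p\<le>n. euler_factor A p)"
    if n: "n \<ge> y" for n
  proof -
    have "(\<Prod>p\<le>n. euler_factor A p) = (\<Prod>p\<le>y. euler_factor A p) * (\<Prod>p\<in>{y<..n}. euler_factor A p)"
      using n by (rule prod_atMost_split)
    also have "(\<Prod>p\<le>y. euler_factor A p) = (\<Prod>p\<le>y. aligned_factor k p)"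
      by (intro prod.cong) (auto simp: al)
    finally have eq: "(\<Prod>p\<le>n. euler_factor A p) =
      (\<Prod>p\<le>y. aligned_factor k p) * (\<Prod>p\<in>{y<..n}. euler_factor A p)" .
    have small: "real (k + 1) ^ 2 / real p ^ 2 \<le> 1" if "p \<in> {y<..n}" for p
    proof -
      have "real (k + 1) ^ 2 \<le> real p ^ 2" using that y by (intro power_mono) auto
      moreover have "real p > 0" using that by simp
      ultimately show ?thesis by (simp add: divide_le_eq_1)
    qed
    have "1 - real (k + 1) ^ 2 / real y \<le> 1 - real (k + 1) ^ 2 * (1 / real y - 1 / real n)"
      by (simp add: algebra_simps)
    also have "\<dots> \<le> 1 - real (k + 1) ^ 2 * (\<Sum>p\<in>{y<..n}. 1 / real p ^ 2)"
      using sum_inverse_squares_le[of y n] y n by (intro diff_left_mono mult_left_mono) auto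
    also have "\<dots> = 1 - (\<Sum>p\<in>{y<..n}. real (k + 1) ^ 2 / real p ^ 2)"
      by (simp add: sum_distrib_left)
    also have "\<dots> \<le> (\<Prod>p\<in>{y<..n}. 1 - real (k + 1) ^ 2 / real p ^ 2)"
      using small by (intro Weierstrass_prod_ineq) auto
    also have "\<dots> \<le> (\<Prod>p\<in>{y<..n}. euler_factor A p)"
      using small euler_factor_ge[OF A(2)] A(1) by (intro prod_mono) auto
    finally show ?thesis unfolding eq
      using aligned_factor_ge_1[of k] by (intro mult_left_mono prod_nonneg) (auto intro: order_trans[of 0 1])
  qed
  then show ?thesis using LIMSEQ_le_const[OF singular_series_LIMSEQ[OF A(2)]] unfolding A_def by blast
qed

text \<open>The primes in B are distinct and all divide the product \<Delta> of the nonzero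
  differences, so y^(card B) \<le> \<Delta> \<le> X^((k+1)^2); take logarithms. Ordered pairs are
  used, hence at most (k+1)^2 differences.\<close>

lemma card_large_primes_dividing_differences:
  fixes A :: "int set"
  assumes "card A = k + 1" "A \<subseteq> {0..X}" "1 \<le> X" "2 \<le> y"
    and B: "B = {p. prime p \<and> y < p \<and> (\<exists>a\<in>A. \<exists>b\<in>A. a \<noteq> b \<and> int p dvd a - b)}"
  shows "finite B" "real (card B) * ln (real y) \<le> real (k + 1) ^ 2 * ln (real_of_int X)"
proof -
  have fin: "finite A" using assms by (auto intro: card_ge_0_finite)
  define Q where "Q = {(a, b) \<in> A \<times> A. a \<noteq> b}"
  define \<Delta> where "\<Delta> = (\<Prod>(a, b)\<in>Q. nat \<bar>a - b\<bar>)"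
  have finQ: "finite Q" unfolding Q_def by (rule finite_subset[of _ "A \<times> A"]) (use fin in auto)
  have \<Delta>: "\<Delta> > 0" unfolding \<Delta>_def by (rule prod_pos) (auto simp: Q_def)
  have dvd: "p dvd \<Delta>" if pB: "p \<in> B" for p
  proof -
    obtain a b where ab: "a \<in> A" "b \<in> A" "a \<noteq> b" "int p dvd a - b" using pB unfolding B by blast
    then have "p dvd nat \<bar>a - b\<bar>" by (simp add: nat_dvd_iff[symmetric] int_dvd_int_iff[symmetric])
    also have "nat \<bar>a - b\<bar> dvd \<Delta>"
      unfolding \<Delta>_def using ab finQ by (intro dvd_prodI[where a = "(a, b)", THEN dvd_trans[rotated]]) (auto simp: Q_def)
    finally show ?thesis .
  qed
  have bound: "nat \<bar>a - b\<bar> \<le> nat X" if "a \<in> A" "b \<in> A" for a b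
  proof -
    have "0 \<le> a \<and> a \<le> X" "0 \<le> b \<and> b \<le> X" using that assms(2) by auto
    then show ?thesis by linarith
  qed
  have "B \<subseteq> {..\<Delta>}" using dvd \<Delta> by (auto intro: dvd_imp_le)
  then show finB: "finite B" by (rule finite_subset) auto
  have "\<Prod>B dvd \<Delta>" using finB dvd B by (intro prod_primes_dvd) auto
  then have 1: "\<Prod>B \<le> \<Delta>" using \<Delta> by (rule dvd_imp_le)
  have "y ^ card B = (\<Prod>p\<in>B. y)" by simp
  also have "\<dots> \<le> \<Prod>B" using B by (intro prod_mono) auto
  also note 1
  also have "\<Delta> \<le> (\<Prod>ab\<in>Q. nat X)"
    unfolding \<Delta>_def using bound by (intro prod_mono) (auto simp: Q_def)
  also have "\<dots> = nat X ^ card Q" by simp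
  also have "\<dots> \<le> nat X ^ (k + 1) ^ 2"
  proof (intro power_increasing)
    have "card Q \<le> card (A \<times> A)" using fin by (intro card_mono) (auto simp: Q_def)
    then show "card Q \<le> (k + 1) ^ 2" using assms by (simp add: card_cartesian_product power2_eq_square)
  qed (use assms in auto)
  finally have "real (y ^ card B) \<le> real (nat X ^ (k + 1) ^ 2)" by (simp only: of_nat_le_iff)
  then have "real y ^ card B \<le> real_of_int X ^ (k + 1) ^ 2" using assms by simp
  then have "ln (real y ^ card B) \<le> ln (real_of_int X ^ (k + 1) ^ 2)"
    using assms by (intro ln_mono) auto
  then show "real (card B) * ln (real y) \<le> real (k + 1) ^ 2 * ln (real_of_int X)"
    using assms by (simp add: ln_realpow)
qed

lemma aligned_factor_le_exp:
  assumes "2 \<le> y" "y < p"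
  shows "aligned_factor k p \<le> exp (2 * real k / real y)"
proof (cases "prime p")
  case True
  have "1 / (1 - 1 / real p) = 1 + 1 / (real p - 1)" using assms by (simp add: field_simps)
  also have "\<dots> \<le> 1 + 2 / real y" using assms by (simp add: field_simps)
  also have "\<dots> \<le> exp (2 / real y)" by (rule exp_ge_add_one_self)
  finally have "(1 / (1 - 1 / real p)) ^ k \<le> exp (2 / real y) ^ k"
    using assms by (intro power_mono) auto
  then show ?thesis using True by (simp add: aligned_factor_def exp_of_nat_mult[symmetric] mult.commute)
qed (auto simp: aligned_factor_def)

text \<open>Split the product at y. Up to y, aligned factors are an upper bound, and q loses a
  further 1 - 1/q. Beyond y a factor exceeds 1 only at primes dividing a difference; these are few
  by the preceding count, and each contributes at most exp(2k/y).\<close>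

lemma singular_series_nonaligned_le:
  assumes "card A = k + 1" "A \<subseteq> {0..X}" "1 \<le> X" "2 \<le> y"
    and ab: "a \<in> A" "b \<in> A" "\<not> int q dvd a - b" and q: "prime q" "q \<le> y"
  shows "singular_series A \<le> (1 - 1 / real q) * (\<Prod>p\<le>y. aligned_factor k p) *
           exp (2 * real k * real (k + 1) ^ 2 * ln (real_of_int X) / (real y * ln (real y)))"
    (is "_ \<le> ?R")
proof -
  have fin: "finite A" using assms by (auto intro: card_ge_0_finite)
  define B where "B = {p. prime p \<and> y < p \<and> (\<exists>a\<in>A. \<exists>b\<in>A. a \<noteq> b \<and> int p dvd a - b)}"
  note B = card_large_primes_dividing_differences[OF assms(1-4) B_def]
  have "(\<Prod>p\<le>n. euler_factor A p) \<le> ?R" if n: "n \<ge> y" for n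
  proof -
    have "(\<Prod>p\<le>n. euler_factor A p) = (\<Prod>p\<le>y. euler_factor A p) * (\<Prod>p\<in>{y<..n}. euler_factor A p)"
      using n by (rule prod_atMost_split)
    also have "\<dots> \<le> ((1 - 1 / real q) * (\<Prod>p\<le>y. aligned_factor k p)) *
        exp (2 * real k * real (k + 1) ^ 2 * ln (real_of_int X) / (real y * ln (real y)))"
    proof (intro mult_mono)
      have "(\<Prod>p\<le>y. euler_factor A p) \<le> (\<Prod>p\<le>y. (if p = q then 1 - 1 / real q else 1) * aligned_factor k p)"
        using euler_factor_le_nonaligned[OF assms(1) ab q(1)] euler_factor_le_aligned[OF assms(1)]
        by (intro prod_mono conjI euler_factor_nonneg) (auto simp: mult.commute)
      also have "\<dots> = (1 - 1 / real q) * (\<Prod>p\<le>y. aligned_factor k p)"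
        using q by (simp add: prod.distrib prod.delta)
      finally show "(\<Prod>p\<le>y. euler_factor A p) \<le> (1 - 1 / real q) * (\<Prod>p\<le>y. aligned_factor k p)" .
      have "(\<Prod>p\<in>{y<..n}. euler_factor A p) \<le> (\<Prod>p\<in>{y<..n}. if p \<in> B then exp (2 * real k / real y) else 1)"
      proof (intro prod_mono conjI euler_factor_nonneg)
        fix p assume p: "p \<in> {y<..n}"
        show "euler_factor A p \<le> (if p \<in> B then exp (2 * real k / real y) else 1)"
        proof (cases "p \<in> B \<or> \<not> prime p")
          case True
          have "euler_factor A p \<le> aligned_factor k p" by (rule euler_factor_le_aligned[OF assms(1)])
          moreover have "aligned_factor k p \<le> exp (2 * real k / real y)"
            using p assms by (intro aligned_factor_le_exp) auto
          moreover have "euler_factor A p = 1" if "\<not> prime p" using that by (simp add: euler_factor_def)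
          ultimately show ?thesis using True by (auto simp: B_def)
        next
          case False
          then have "residue_count A p = card A"
            using p by (intro residue_count_eq_card) (auto simp: B_def)
          then show ?thesis using False euler_factor_le_1[OF fin] by auto
        qed
      qed
      also have "\<dots> = exp (2 * real k / real y) ^ card ({y<..n} \<inter> B)"
        by (simp add: prod.If_cases)
      also have "\<dots> \<le> exp (2 * real k / real y) ^ card B"
        using B(1) by (intro power_increasing card_mono) auto
      also have "\<dots> = exp (real (card B) * (2 * real k / real y))"
        by (rule exp_of_nat_mult[symmetric])
      also have "\<dots> \<le> exp (real (k + 1) ^ 2 * ln (real_of_int X) / ln (real y) * (2 * real k / real y))"
        using B(2) assms(4) by (simp only: exp_le_cancel_iff) (intro mult_right_mono, auto simp: field_simps)
      also have "real (k + 1) ^ 2 * ln (real_of_int X) / ln (real y) * (2 * real k / real y) =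
          2 * real k * real (k + 1) ^ 2 * ln (real_of_int X) / (real y * ln (real y))"
        by (simp add: mult_ac)
      finally show "(\<Prod>p\<in>{y<..n}. euler_factor A p) \<le> exp \<dots>" .
      show "0 \<le> (1 - 1 / real q) * (\<Prod>p\<le>y. aligned_factor k p)"
        using prime_gt_1_nat[OF q(1)] aligned_factor_ge_1[of k]
        by (intro mult_nonneg_nonneg prod_nonneg) (auto intro: order_trans[of 0 1])
    qed (auto intro!: prod_nonneg euler_factor_nonneg)
    finally show ?thesis .
  qed
  then show ?thesis using LIMSEQ_le_const2[OF singular_series_LIMSEQ[OF fin]] by blast
qed

section \<open>Consequences of the conjecture\<close>

text \<open>\<open>Li_tuple m x D\<close> is \<open>LI m\<close> at \<open>x - Max D\<close>. As a
  function of the endpoint alone it can be compared at different endpoints; it is 0 up to 2, hence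
  monotone on all of \<real>.\<close>

definition LI :: "nat \<Rightarrow> real \<Rightarrow> real" where
  "LI m y = integral {2..y} (\<lambda>t. 1 / ln t ^ m)"

lemma integrable_inverse_ln_power: "2 \<le> a \<Longrightarrow> (\<lambda>t::real. 1 / ln t ^ m) integrable_on {a..b}"
  by (intro integrable_continuous_real continuous_intros) auto

lemma LI_diff:
  assumes "2 \<le> a" "a \<le> b"
  shows "LI m b - LI m a = integral {a..b} (\<lambda>t. 1 / ln t ^ m)"
  using Henstock_Kurzweil_Integration.integral_combine[OF assms integrable_inverse_ln_power[of 2 m b]]
  by (simp add: LI_def)

lemma LI_diff_ge:
  assumes "2 \<le> a" "a \<le> b"
  shows "(b - a) / ln b ^ m \<le> LI m b - LI m a"
proof -
  have "integral {a..b} (\<lambda>t. 1 / ln b ^ m) \<le> integral {a..b} (\<lambda>t. 1 / ln t ^ m)"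
    using assms by (intro integral_le integrable_inverse_ln_power divide_left_mono power_mono) auto
  then show ?thesis using assms by (simp add: LI_diff)
qed

lemma LI_diff_le:
  assumes "2 \<le> a" "a \<le> b"
  shows "LI m b - LI m a \<le> (b - a) / ln a ^ m"
proof -
  have "integral {a..b} (\<lambda>t. 1 / ln t ^ m) \<le> integral {a..b} (\<lambda>t. 1 / ln a ^ m)"
    using assms by (intro integral_le integrable_inverse_ln_power divide_left_mono power_mono) auto
  then show ?thesis using assms by (simp add: LI_diff)
qed

lemma LI_eq_0: "y \<le> 2 \<Longrightarrow> LI m y = 0"
  by (cases "y = 2") (auto simp: LI_def)

lemma LI_ge:
  assumes "2 \<le> y"
  shows "(y - 2) / ln y ^ m \<le> LI m y"
  using LI_diff_ge[of 2 y m] assms by (simp add: LI_eq_0)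

lemma LI_nonneg: "LI m y \<ge> 0"
proof (cases "2 \<le> y")
  case True
  then show ?thesis using order_trans[OF _ LI_ge[OF True, of m], of 0] by simp
qed (simp add: LI_eq_0)

lemma LI_mono:
  assumes "y \<le> z"
  shows "LI m y \<le> LI m z"
proof (cases "2 \<le> y")
  case True
  have "0 \<le> (z - y) / ln z ^ m" using True assms by simp
  then show ?thesis using LI_diff_ge[OF True assms, of m] by linarith
qed (simp add: LI_eq_0 LI_nonneg)

text \<open>Writing the factor as M / (M + 1), k \<ge> 1 gives M \<ge> 2^2 * 2! = 8, and the
  reciprocal exceeds 1 by 1/M. The bounds are uniform in k.\<close>

lemma range_factor_bounds:
  assumes "k \<ge> 1"
  shows "8 / 9 \<le> range_factor k" "range_factor k < 1"
    and "1 / range_factor k - 1 \<le> 1 / 8"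
proof -
  define M where "M = (2::real) ^ (k + 1) * fact (k + 1)"
  have "(2::real) ^ 2 \<le> 2 ^ (k + 1)" using assms by (intro power_increasing) auto
  moreover have "(fact 2 :: real) \<le> fact (k + 1)" using assms by (intro fact_mono) auto
  ultimately have "(2::real) ^ 2 * fact 2 \<le> M" unfolding M_def by (intro mult_mono) auto
  then have M: "M \<ge> 8" by (simp add: fact_numeral)
  have eq: "range_factor k = M / (M + 1)" by (simp add: range_factor_def M_def)
  show "8 / 9 \<le> range_factor k" "range_factor k < 1" "1 / range_factor k - 1 \<le> 1 / 8"
    unfolding eq using M by (simp_all add: field_simps)
qed

section \<open>Difference sets and their tuple counts\<close>

lemma difference_set_Max:
  assumes "difference_set k D" "k \<ge> 1"
  shows "finite D" "D \<noteq> {}" "Max D \<in> D" "0 < Max D" "0 \<notin> D" "card (insert 0 D) = k + 1"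
    "insert 0 D \<subseteq> {0..Max D}"
proof -
  show D: "finite D" "D \<noteq> {}" using assms by (auto simp: difference_set_def)
  then show "Max D \<in> D" by (rule Max_in)
  then show "0 < Max D" "0 \<notin> D" using assms by (auto simp: difference_set_def)
  then show "card (insert 0 D) = k + 1" using assms D by (simp add: difference_set_def)
  show "insert 0 D \<subseteq> {0..Max D}"
    using assms D \<open>0 < Max D\<close> by (auto simp: difference_set_def order_less_imp_le)
qed

lemma difference_set_scale:
  assumes "difference_set k D" "q > 0"
  shows "difference_set k ((*) q ` D)"
proof -
  have "card ((*) q ` D) = card D" using assms by (intro card_image) (auto simp: inj_on_def)
  then show ?thesis using assms by (auto simp: difference_set_def)
qed

lemma Max_scale:
  assumes "finite D" "D \<noteq> {}" "(q::int) > 0"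
  shows "Max ((*) q ` D) = q * Max D"
  using mono_Max_commute[of "(*) q" D] assms by (simp add: mono_def)

lemma tuple_set_finite:
  "finite {p::int. prime p \<and> real_of_int p \<le> y \<and> (\<forall>d\<in>D. prime (p + d))}"
  by (rule finite_subset[of _ "{0..\<lfloor>y\<rfloor>}"]) (auto simp: le_floor_iff dest: prime_ge_0_int)

lemma tuple_count_mono:
  assumes "x \<le> x'"
  shows "tuple_count x D \<le> tuple_count x' D"
  unfolding tuple_count_def using assms by (intro card_mono tuple_set_finite) auto

lemma tuple_count_pos_imp_Max_le:
  assumes "tuple_count x D > 0"
  shows "real_of_int (Max D) \<le> x"
proof -
  obtain p :: int where p: "prime p" "real_of_int p \<le> x - real_of_int (Max D)"
    using assms unfolding tuple_count_def card_gt_0_iff by auto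
  moreover have "p > 0" using p(1) by (rule prime_gt_0_int)
  ultimately show ?thesis by linarith
qed

text \<open>If the tuple covers all residues modulo \<open>q\<close>, one of its members must be \<open>q\<close> itself.\<close>

lemma tuple_count_degenerate:
  assumes "finite D" "prime q" "residue_count (insert 0 D) q = q"
  shows "tuple_count x D \<le> card D + 1"
proof -
  let ?A = "insert 0 D"
  have q: "q > 0" using assms by (intro prime_gt_0_nat)
  have "(\<lambda>a. a mod int q) ` ?A = {0..<int q}"
  proof (rule card_subset_eq)
    show "card ((\<lambda>a. a mod int q) ` ?A) = card {0..<int q}"
      using assms(3) by (simp add: residue_count_def)
  qed (use q in auto)
  then have cover: "\<exists>a\<in>?A. a mod int q = r mod int q" for r
  proof -
    assume *: "(\<lambda>a. a mod int q) ` ?A = {0..<int q}"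
    have "r mod int q \<in> {0..<int q}" using q by auto
    then show ?thesis unfolding *[symmetric] by (metis (mono_tags, lifting) imageE)
  qed
  have "{p::int. prime p \<and> real_of_int p \<le> x - real_of_int (Max D) \<and> (\<forall>d\<in>D. prime (p + d))}
          \<subseteq> (\<lambda>a. int q - a) ` ?A"
  proof
    fix r assume r: "r \<in> {p::int. prime p \<and> real_of_int p \<le> x - real_of_int (Max D) \<and> (\<forall>d\<in>D. prime (p + d))}"
    \<comment> \<open>The class of -r is represented by some a, so the prime r + a is divisible by q
      and equals q; thus r is one of at most card D + 1 values q - a.\<close>
    obtain a where a: "a \<in> ?A" "a mod int q = (- r) mod int q" using cover[of "- r"] by blast
    then have "int q dvd r + a" by (simp add: mod_eq_dvd_iff add.commute)
    moreover have "prime (r + a)" using r a by auto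
    ultimately have "int q = r + a" using assms(2) by (intro primes_dvd_imp_eq) auto
    then show "r \<in> (\<lambda>a. int q - a) ` ?A" using a by (intro image_eqI[of _ _ a]) auto
  qed
  then have "tuple_count x D \<le> card ((\<lambda>a. int q - a) ` ?A)"
    unfolding tuple_count_def using assms by (intro card_mono) auto
  also have "\<dots> \<le> card ?A" using assms by (intro card_image_le) auto
  also have "\<dots> \<le> card D + 1" using assms by (simp add: card_insert_if)
  finally show ?thesis .
qed

text \<open>The pair 0, 1 would cover both classes modulo 2. This supplies the lower end of the
  range in the conjecture.\<close>

lemma nondegenerate_imp_ge_2:
  assumes "difference_set k D" "singular_series (insert 0 D) \<noteq> 0" "d \<in> D"
  shows "2 \<le> d"
proof (rule ccontr)
  assume "\<not> 2 \<le> d"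
  then have "d = 1" using assms by (auto simp: difference_set_def)
  then have "residue_count (insert 0 D) 2 \<ge> 2"
    using assms by (intro residue_count_ge_2[of _ d 0]) (auto simp: difference_set_def)
  then have "residue_count (insert 0 D) 2 = 2" using residue_count_le[of 2 "insert 0 D"] by simp
  then have "singular_series (insert 0 D) = 0"
    using assms by (subst singular_series_eq_0_iff) (auto simp: difference_set_def intro!: exI[of _ 2])
  then show False using assms by simp
qed

text \<open>The form in which the conjecture is used: the range condition on all differences reduces
  to an upper bound for the largest one, and the integral becomes a value of
  \<open>LI\<close>.\<close>

lemma conjecture_bound:
  assumes "k \<ge> 1" "uniform_tuple_conjecture k" "\<eta> > 0"
  shows "\<forall>\<^sub>F x in at_top. \<forall>D. difference_set k D \<and> singular_series (insert 0 D) \<noteq> 0 \<and>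
           real_of_int (Max D) \<le> range_factor k * x \<longrightarrow>
           \<bar>real (tuple_count x D) - singular_series (insert 0 D) * LI (k + 1) (x - real_of_int (Max D))\<bar>
             \<le> \<eta> * (x / ln x ^ (k + 3))"
proof -
  have "\<forall>\<^sub>F x in at_top. \<forall>D.
        difference_set k D \<and> singular_series ({0} \<union> D) \<noteq> 0 \<and>
        (\<forall>d\<in>D. 2 \<le> real_of_int d \<and> real_of_int d \<le> range_factor k * x)
        \<longrightarrow> \<bar>tuple_error k x D\<bar> \<le> \<eta> * (x / ln x ^ (k + 3))"
    using assms unfolding uniform_tuple_conjecture_def by blast
  then show ?thesis
  proof eventually_elim
    case (elim x)
    show ?case
    proof (intro allI impI, elim conjE)
      fix D assume D: "difference_set k D" "singular_series (insert 0 D) \<noteq> 0"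
        "real_of_int (Max D) \<le> range_factor k * x"
      have "\<bar>tuple_error k x D\<bar> \<le> \<eta> * (x / ln x ^ (k + 3))"
      proof (rule elim[rule_format], intro conjI ballI)
        fix d assume d: "d \<in> D"
        show "2 \<le> real_of_int d" using nondegenerate_imp_ge_2[OF D(1,2) d] by simp
        have "d \<le> Max D" using d difference_set_Max(1)[OF D(1) assms(1)] by simp
        then show "real_of_int d \<le> range_factor k * x" using D(3) by linarith
      qed (use D in auto)
      then show "\<bar>real (tuple_count x D) - singular_series (insert 0 D) * LI (k + 1) (x - real_of_int (Max D))\<bar>
             \<le> \<eta> * (x / ln x ^ (k + 3))"
        by (simp add: tuple_error_def Li_tuple_def LI_def)
    qed
  qed
qed

lemma tuple_count_lower:
  assumes "k \<ge> 1" "uniform_tuple_conjecture k" "\<eta> > 0"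
  shows "\<forall>\<^sub>F x in at_top. \<forall>D. difference_set k D \<and> singular_series (insert 0 D) \<noteq> 0 \<and>
           real_of_int (Max D) \<le> 8 / 9 * x \<longrightarrow>
           singular_series (insert 0 D) * LI (k + 1) (x - real_of_int (Max D)) - \<eta> * (x / ln x ^ (k + 3))
             \<le> real (tuple_count x D)"
  using conjecture_bound[OF assms] eventually_ge_at_top[of "0::real"]
proof eventually_elim
  case (elim x)
  have "8 / 9 * x \<le> range_factor k * x"
    using range_factor_bounds[OF assms(1)] elim(2) by (intro mult_right_mono) auto
  then have "real_of_int (Max D) \<le> range_factor k * x" if "real_of_int (Max D) \<le> 8 / 9 * x" for D
    using that by linarith
  then show ?case using elim(1) by (smt (verit, best))
qed

text \<open>When \<open>Max D\<close> exceeds the range of the conjecture, the conjecture is applied at the larger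
  point \<open>x' = Max D / range_factor k\<close>; this loses little since \<open>x' - Max D \<le> Max D / 8\<close>.\<close>

lemma tuple_count_upper:
  assumes "k \<ge> 1" "uniform_tuple_conjecture k" "\<eta> > 0"
  shows "\<forall>\<^sub>F x in at_top. \<forall>D. difference_set k D \<and> k + 1 < tuple_count x D \<longrightarrow>
           singular_series (insert 0 D) \<noteq> 0 \<and> real_of_int (Max D) \<le> x \<and>
           real (tuple_count x D) \<le> singular_series (insert 0 D) *
             LI (k + 1) (max (x - real_of_int (Max D)) (real_of_int (Max D) / 8)) + \<eta> * (x / ln x ^ (k + 3))"
proof -
  define c where "c = range_factor k"
  have c: "8 / 9 \<le> c" "c < 1" "1 / c - 1 \<le> 1 / 8"
    using range_factor_bounds[OF assms(1)] by (auto simp: c_def)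
  \<comment> \<open>The tolerance is shrunk by c because the evaluation point may grow to x / c; the
    error there is then again at most \<eta> x / ln^(k+3) x.\<close>
  have "\<eta> * c > 0" using assms c by simp
  from conjecture_bound[OF assms(1,2) this] obtain x0 where x0:
    "\<And>x D. x \<ge> x0 \<Longrightarrow> difference_set k D \<Longrightarrow> singular_series (insert 0 D) \<noteq> 0 \<Longrightarrow>
       real_of_int (Max D) \<le> c * x \<Longrightarrow>
       \<bar>real (tuple_count x D) - singular_series (insert 0 D) * LI (k + 1) (x - real_of_int (Max D))\<bar>
         \<le> \<eta> * c * (x / ln x ^ (k + 3))"
    unfolding eventually_at_top_linorder c_def by blast
  show ?thesis
    using eventually_ge_at_top[of x0] eventually_gt_at_top[of 1]
  proof eventually_elim
    case (elim x)
    show ?case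
    proof (intro allI impI, elim conjE)
      fix D assume D: "difference_set k D" "k + 1 < tuple_count x D"
      note max = difference_set_Max[OF D(1) assms(1)]
      define d where "d = real_of_int (Max D)"
      define S where "S = singular_series (insert 0 D)"
      have d: "0 < d" "d \<le> x"
        using max(4) tuple_count_pos_imp_Max_le[of x D] D(2) by (auto simp: d_def)
      have S: "S \<noteq> 0"
      \<comment> \<open>A vanishing singular series would cap the count at k + 1, against the
        assumed lower bound.\<close>
      proof
        assume "S = 0"
        then obtain q where "prime q" "residue_count (insert 0 D) q = q"
          using singular_series_eq_0_iff[of "insert 0 D"] max(1) by (auto simp: S_def)
        then have "tuple_count x D \<le> card D + 1" using max(1) by (intro tuple_count_degenerate)
        then show False using D by (simp add: difference_set_def)
      qed
      have Snn: "S \<ge> 0" unfolding S_def using max(1) by (intro singular_series_nonneg) auto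
      define x' where "x' = max x (d / c)"
      have x': "x' = max x (d / c)" "x \<le> x'" by (auto simp: x'_def)
      have "d / c \<le> x / c" using d c by (intro divide_right_mono) auto
      moreover have "x * c \<le> x * 1" using elim c by (intro mult_left_mono) auto
      then have "x \<le> x / c" using c by (simp add: field_simps)
      ultimately have x'c: "x' \<le> x / c" by (simp add: x'(1))
      have "d \<le> c * x'" using x' c by (simp add: max_def field_simps)
      then have *: "\<bar>real (tuple_count x' D) - S * LI (k + 1) (x' - d)\<bar> \<le> \<eta> * c * (x' / ln x' ^ (k + 3))"
        unfolding d_def S_def using D S elim x' by (intro x0) (auto simp: S_def)
      have "d / c - d = d * (1 / c - 1)" by (simp add: algebra_simps)
      also have "\<dots> \<le> d * (1 / 8)" using c d by (intro mult_left_mono) auto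
      finally have "d / c - d \<le> d / 8" by simp
      then have "x' - d \<le> max (x - d) (d / 8)" unfolding x'(1) by linarith
      then have LI: "S * LI (k + 1) (x' - d) \<le> S * LI (k + 1) (max (x - d) (d / 8))"
        using Snn by (intro mult_left_mono LI_mono)
      have "x' / ln x' ^ (k + 3) \<le> (x / c) / ln x ^ (k + 3)"
        using x'c x' elim by (intro frac_le power_mono) auto
      then have "\<eta> * c * (x' / ln x' ^ (k + 3)) \<le> \<eta> * c * ((x / c) / ln x ^ (k + 3))"
        using assms c by (intro mult_left_mono) auto
      also have "\<dots> = \<eta> * (x / ln x ^ (k + 3))" using c by simp
      finally have "real (tuple_count x' D) \<le> S * LI (k + 1) (max (x - d) (d / 8)) + \<eta> * (x / ln x ^ (k + 3))"
        using * LI by linarith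
      moreover have "tuple_count x D \<le> tuple_count x' D" using x' by (intro tuple_count_mono) auto
      ultimately have "real (tuple_count x D) \<le> S * LI (k + 1) (max (x - d) (d / 8)) + \<eta> * (x / ln x ^ (k + 3))"
        by linarith
      then show "singular_series (insert 0 D) \<noteq> 0 \<and> real_of_int (Max D) \<le> x \<and>
           real (tuple_count x D) \<le> singular_series (insert 0 D) *
             LI (k + 1) (max (x - real_of_int (Max D)) (real_of_int (Max D) / 8)) + \<eta> * (x / ln x ^ (k + 3))"
        using S d by (simp add: S_def d_def)
    qed
  qed
qed

lemma ln_power_le_sqrt:
  fixes K :: real
  shows "\<forall>\<^sub>F x::real in at_top. K * ln x ^ n \<le> sqrt x"
  by real_asymp

text \<open>Needed because 1/9 is the share of x left to the integral when the largest difference is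
  at most 8/9 x.\<close>

lemma ln_scaled_power_ge: "\<forall>\<^sub>F x::real in at_top. ln x ^ n \<le> 2 * ln (x / 9) ^ n"
proof -
  have "((\<lambda>x::real. ln (x / 9) / ln x) \<longlongrightarrow> 1) at_top" by real_asymp
  then have "((\<lambda>x::real. (ln (x / 9) / ln x) ^ n) \<longlongrightarrow> 1 ^ n) at_top" by (rule tendsto_power)
  then have "\<forall>\<^sub>F x::real in at_top. (ln (x / 9) / ln x) ^ n > 1 / 2"
    by (rule order_tendstoD) auto
  then show ?thesis using eventually_gt_at_top[of 1]
  proof eventually_elim
    case (elim x)
    then show ?case by (simp add: power_divide field_simps)
  qed
qed

section \<open>Small primes divide the gcd of a champion\<close>

text \<open>The divisor 6 is chosen for the bound 16^n on primorials: since ln 16 \<le> 3, a height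
  of (ln x) / 6 keeps the primorial below exp((ln x) / 2) = sqrt x.\<close>

definition test_height :: "real \<Rightarrow> nat" where
  "test_height x = nat \<lfloor>ln x / 6\<rfloor>"

definition test_series :: "nat \<Rightarrow> real \<Rightarrow> real" where
  "test_series k x = singular_series ((*) (int (primorial (test_height x))) ` {0..int k})"

lemma primorial_test_height_le_sqrt:
  assumes "x \<ge> 1"
  shows "real (primorial (test_height x)) \<le> sqrt x"
proof -
  have y: "real (test_height x) \<le> ln x / 6"
    using of_int_floor_le[of "ln x / 6"] assms unfolding test_height_def by simp
  have "ln (16::real) = 4 * ln 2" using ln_realpow[of 2 4] by simp
  then have ln16: "ln (16::real) \<le> 3" using ln2_le_25_over_36 by simp
  have "real (primorial (test_height x)) \<le> 16 ^ test_height x"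
    using primorial_le[of "test_height x"] by (metis of_nat_le_iff of_nat_numeral of_nat_power)
  also have "\<dots> = exp (real (test_height x) * ln 16)" by (simp add: exp_of_nat_mult)
  also have "real (test_height x) * ln 16 \<le> ln x / 6 * 3"
    using y ln16 assms by (intro mult_mono) auto
  also have "exp (ln x / 6 * 3) = sqrt x"
    using assms by (simp add: ln_sqrt[symmetric])
  finally show ?thesis by simp
qed

lemma test_series_ge:
  assumes "k + 1 \<le> test_height x"
  shows "(\<Prod>p\<le>test_height x. aligned_factor k p) * (1 - real (k + 1) ^ 2 / real (test_height x)) \<le> test_series k x"
  unfolding test_series_def using assms by (rule singular_series_test_set_ge)

lemma test_height_ge: "\<forall>\<^sub>F x in at_top. ln x / 7 \<le> real (test_height x)"
proof -
  have "\<forall>\<^sub>F x::real in at_top. 42 \<le> ln x" by real_asymp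
  then show ?thesis
  proof eventually_elim
    case (elim x)
    have "ln x / 6 - 1 \<le> real (test_height x)" unfolding test_height_def using elim by linarith
    then show ?case using elim by linarith
  qed
qed

lemma test_series_ge_half: "\<forall>\<^sub>F x in at_top. 1 / 2 \<le> test_series k x"
proof -
  have "\<forall>\<^sub>F x::real in at_top. 2 * real (k + 1) ^ 2 \<le> ln x / 7" by real_asymp
  with test_height_ge show ?thesis
  proof eventually_elim
    case (elim x)
    let ?y = "test_height x"
    have y: "2 * real (k + 1) ^ 2 \<le> real ?y" using elim by linarith
    have "real (k + 1) \<le> real (k + 1) ^ 2" by (rule self_le_power) auto
    then have ky: "real (k + 1) \<le> real ?y" using y by linarith
    have y0: "real ?y > 0" using ky by simp
    have "1 / 2 = 1 * (1 - 1 / (2::real))" by simp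
    also have "\<dots> \<le> (\<Prod>p\<le>?y. aligned_factor k p) * (1 - real (k + 1) ^ 2 / real ?y)"
    proof (intro mult_mono)
      show "1 \<le> (\<Prod>p\<le>?y. aligned_factor k p)" by (intro prod_ge_1 aligned_factor_ge_1)
      then show "0 \<le> (\<Prod>p\<le>?y. aligned_factor k p)" by linarith
      show "1 - 1 / 2 \<le> 1 - real (k + 1) ^ 2 / real ?y" using y y0 by (simp add: field_simps)
    qed auto
    also have "\<dots> \<le> test_series k x" using ky by (intro test_series_ge) linarith
    finally show ?case .
  qed
qed

text \<open>The largest element of {P, 2P, ..., kP} is at most k sqrt x, so the integral is
  shortened by at most that length; there the integrand is at most 1 / ln^(k+1) 2, which explains
  \<open>K\<close>.\<close>

lemma test_set_count_lower:
  assumes "k \<ge> 1" "uniform_tuple_conjecture k" "K = real k / ln 2 ^ (k + 1)"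
  shows "\<forall>\<^sub>F x in at_top. \<exists>D. difference_set k D \<and>
           test_series k x * (LI (k + 1) x - K * sqrt x) - x / ln x ^ (k + 3) \<le> real (tuple_count x D)"
proof -
  have "\<forall>\<^sub>F x::real in at_top. real k * sqrt x \<le> x / 2" by real_asymp
  moreover have "\<forall>\<^sub>F x::real in at_top. x \<ge> 4" by (rule eventually_ge_at_top)
  ultimately show ?thesis
    using tuple_count_lower[OF assms(1,2) zero_less_one] test_series_ge_half[of k]
  proof eventually_elim
    case (elim x)
    define P where "P = int (primorial (test_height x))"
    define D where "D = (*) P ` {1..int k}"
    have P: "P > 0" "real_of_int P \<le> sqrt x"
      using primorial_pos primorial_test_height_le_sqrt[of x] elim by (auto simp: P_def)
    have "difference_set k {1..int k}" by (auto simp: difference_set_def)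
    then have D: "difference_set k D" unfolding D_def using P by (intro difference_set_scale)
    have A: "insert 0 D = (*) P ` {0..int k}"
    proof -
      have "{0..int k} = insert 0 {1..int k}" using assms by auto
      then show ?thesis by (simp add: D_def)
    qed
    then have S: "singular_series (insert 0 D) = test_series k x"
      by (simp add: test_series_def P_def)
    have "Max {1..int k} = int k" using assms by (intro Max_eqI) auto
    then have "Max D = P * int k" unfolding D_def using assms P by (subst Max_scale) auto
    then have "real_of_int (Max D) = real k * real_of_int P" by simp
    also have "\<dots> \<le> real k * sqrt x" using P by (intro mult_left_mono) auto
    finally have M: "real_of_int (Max D) \<le> real k * sqrt x" .
    have M2: "real_of_int (Max D) \<le> x / 2" using M elim by linarith
    have M0: "0 < Max D" using difference_set_Max[OF D assms(1)] by simp
    let ?a = "x - real_of_int (Max D)"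
    have "LI (k + 1) x - LI (k + 1) ?a \<le> (x - ?a) / ln ?a ^ (k + 1)"
      using M2 M0 elim by (intro LI_diff_le) auto
    also have "\<dots> \<le> (real k * sqrt x) / ln 2 ^ (k + 1)"
      using M M2 M0 elim by (intro frac_le power_mono) auto
    also have "\<dots> = K * sqrt x" using assms by simp
    finally have "test_series k x * (LI (k + 1) x - K * sqrt x) \<le> test_series k x * LI (k + 1) ?a"
      using elim by (intro mult_left_mono) auto
    moreover have "test_series k x * LI (k + 1) ?a - 1 * (x / ln x ^ (k + 3)) \<le> real (tuple_count x D)"
      unfolding S[symmetric]
      using elim(3)[rule_format, of D] D S elim(4) M2 elim(2) by simp
    ultimately show ?case using D by (intro exI[of _ D]) auto
  qed
qed

lemma LI_ge_half: "\<forall>\<^sub>F x in at_top. x / (2 * ln x ^ m) \<le> LI m x"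
  using eventually_ge_at_top[of "4::real"]
proof eventually_elim
  case (elim x)
  have "x / (2 * ln x ^ m) = (x / 2) / ln x ^ m" by simp
  also have "\<dots> \<le> (x - 2) / ln x ^ m" using elim by (intro divide_right_mono) auto
  also have "\<dots> \<le> LI m x" using elim by (intro LI_ge) auto
  finally show ?case .
qed

text \<open>The champion's count is at least that of the competitor. This first pushes it above k +
  1, so that the upper bound applies, and then compares main terms. Errors are smaller than main
  terms by a factor of order ln^2 x, so a relative slack of 1 / ln x is ample.\<close>

lemma champion_nondegenerate:
  assumes "k \<ge> 1" "uniform_tuple_conjecture k"
  shows "\<forall>\<^sub>F x in at_top. \<forall>D. difference_champion k x D \<longrightarrow>
           k + 1 < tuple_count x D \<and> test_series k x * (1 - 1 / ln x) \<le> singular_series (insert 0 D)"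
proof -
  define K where "K = real k / ln 2 ^ (k + 1)"
  have "\<forall>\<^sub>F x::real in at_top. K * ln x ^ (k + 3) \<le> sqrt x"
       "\<forall>\<^sub>F x::real in at_top. real (k + 2) * ln x ^ (k + 3) \<le> sqrt x"
    by (rule ln_power_le_sqrt)+
  moreover have "\<forall>\<^sub>F x::real in at_top. ln x > 10" by real_asymp
  moreover have "\<forall>\<^sub>F x::real in at_top. x > 1" by (rule eventually_gt_at_top)
  moreover have "\<forall>\<^sub>F x::real in at_top. sqrt x \<le> x" by real_asymp
  ultimately show ?thesis
    using test_set_count_lower[OF assms K_def] test_series_ge_half[of k] LI_ge_half[of "k + 1"]
      tuple_count_upper[OF assms zero_less_one]
  proof eventually_elim
    case (elim x)
    define L where "L = ln x"
    define u where "u = L ^ (k + 1)"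
    define S' where "S' = test_series k x"
    define T where "T = LI (k + 1) x"
    have L: "L > 10" and x: "x > 1" using elim by (auto simp: L_def)
    have u: "u > 0" unfolding u_def using L by simp
    have u3: "L ^ (k + 3) = u * L ^ 2" by (simp add: u_def power_add power2_eq_square power3_eq_cube)
    have S': "S' \<ge> 1 / 2" using elim by (simp add: S'_def)
    have T: "x / (2 * u) \<le> T" using elim by (simp add: T_def u_def L_def)
    have Kx: "K * sqrt x \<le> x / (u * L ^ 2)"
    proof -
      have "K * (u * L ^ 2) * sqrt x \<le> sqrt x * sqrt x"
        using elim(1) x unfolding u3[symmetric] unfolding L_def by (intro mult_right_mono) auto
      then show ?thesis using u L x by (simp add: field_simps)
    qed
    have z3: "x / ln x ^ (k + 3) = x / (u * L ^ 2)" unfolding u3[symmetric] by (simp add: L_def)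
    obtain D0 where D0: "difference_set k D0" "S' * (T - K * sqrt x) - x / (u * L ^ 2) \<le> real (tuple_count x D0)"
      using elim(6) unfolding S'_def T_def z3 by blast
    have Lu: "L ^ 2 \<ge> 100" using power_mono[of 10 L 2] L by simp
    show ?case
    proof (intro allI impI)
      fix D assume D: "difference_champion k x D"
      then have ds: "difference_set k D" and "tuple_count x D0 \<le> tuple_count x D"
        using D0 by (auto simp: difference_champion_def)
      then have cnt: "S' * (T - K * sqrt x) - x / (u * L ^ 2) \<le> real (tuple_count x D)"
        using D0(2) by linarith
      \<comment> \<open>\<open>z\<close> is the scale of the error terms; the main integral T
        exceeds it by a factor of at least L^2 / 2.\<close>
      define z where "z = x / (u * L ^ 2)"
      have z: "z > 0" using x u L by (simp add: z_def)
      have Tz: "T \<ge> z * L ^ 2 / 2" using T L u by (simp add: z_def)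
      have Kz: "K * sqrt x \<le> z" using Kx by (simp add: z_def)
      have z100: "z * 100 \<le> z * L ^ 2" using z Lu by (intro mult_left_mono) auto
      \<comment> \<open>From L > 10: T \<ge> 50 z, and the shortening of the integral costs at most
        z.\<close>
      have "49 * z \<le> T - K * sqrt x" using Tz Kz z100 by linarith
      then have "1 / 2 * (49 * z) \<le> S' * (T - K * sqrt x)"
        using S' z by (intro mult_mono) auto
      then have "real (tuple_count x D) \<ge> z"
        using cnt z unfolding z_def[symmetric] by linarith
      moreover have "z > real (k + 1)"
      proof -
        have "real (k + 2) * (u * L ^ 2) \<le> x" using elim(2,5) unfolding u3[symmetric] unfolding L_def by linarith
        then have "real (k + 2) \<le> z" using u L by (simp add: z_def field_simps)
        then show ?thesis by simp
      qed
      ultimately have big: "k + 1 < tuple_count x D" by linarith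
      define S where "S = singular_series (insert 0 D)"
      have Max: "real_of_int (Max D) \<le> x" and up: "real (tuple_count x D) \<le> S *
          LI (k + 1) (max (x - real_of_int (Max D)) (real_of_int (Max D) / 8)) + 1 * (x / ln x ^ (k + 3))"
        using elim(9)[rule_format, of D] ds big by (auto simp: S_def)
      have "S \<ge> 0" unfolding S_def
        using difference_set_Max[OF ds assms(1)] by (intro singular_series_nonneg) auto
      moreover have "0 < Max D" using difference_set_Max[OF ds assms(1)] by simp
      \<comment> \<open>Both candidates in the maximum are at most x, so the full integral
        dominates.\<close>
      ultimately have "S * LI (k + 1) (max (x - real_of_int (Max D)) (real_of_int (Max D) / 8)) \<le> S * T"
        unfolding T_def using Max by (intro mult_left_mono LI_mono) auto
      then have main: "S' * (T - K * sqrt x) - z \<le> S * T + z"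
        using up cnt unfolding z3 z_def by linarith
      have "S' * (1 - 1 / L) \<le> S"
      proof (rule ccontr)
        assume "\<not> S' * (1 - 1 / L) \<le> S"
        have T0: "T > 0" using Tz z z100 by linarith
        have "S * T \<le> S' * (1 - 1 / L) * T"
          using \<open>\<not> _\<close> T0 by (intro mult_right_mono) auto
        then have "S' * (T / L) \<le> S' * (K * sqrt x) + 2 * z"
          using main by (simp add: algebra_simps)
        also have "S' * (K * sqrt x) \<le> S' * z" using S' Kz by (intro mult_left_mono) auto
        \<comment> \<open>S' \<ge> 1/2 turns the absolute error into a multiple of S', which then
          cancels; T \<ge> z L^2 / 2 finally contradicts L > 10.\<close>
        also have "2 * z \<le> S' * (4 * z)" using S' z by simp
        finally have "S' * (T / L) \<le> S' * (5 * z)" by (simp add: algebra_simps)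
        then have "T / L \<le> 5 * z" by (rule mult_left_le_imp_le) (use S' in linarith)
        then have "T \<le> 5 * z * L" using L by (simp add: field_simps)
        then have "z * L ^ 2 / 2 \<le> 5 * z * L" using Tz by linarith
        then have "L \<le> 10" using z L by (simp add: power2_eq_square)
        then show False using L by simp
      qed
      then show "k + 1 < tuple_count x D \<and> test_series k x * (1 - 1 / ln x) \<le> singular_series (insert 0 D)"
        using big by (simp add: S'_def S_def L_def)
    qed
  qed
qed

lemma not_dvd_Gcd_imp:
  fixes D :: "int set"
  assumes "\<not> int q dvd Gcd D"
  obtains d where "d \<in> D" "\<not> int q dvd d - 0"
  using assms Gcd_greatest[of D "int q"] by auto

text \<open>A missed prime p costs a factor 1 - 1/p, the primes beyond the test height can regain at
  most exp(K / ln (ln x)), and the competitor shows that a champion is within 1 - O(1 / ln x) of the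
  product of aligned factors. For p \<le> C ln (ln x) the cost outweighs both.\<close>

lemma champion_small_primes:
  assumes "k \<ge> 1" "uniform_tuple_conjecture k"
  shows "\<exists>C>0. \<forall>\<^sub>F x in at_top. \<forall>D. difference_champion k x D \<longrightarrow>
            (\<forall>p::nat. prime p \<and> real p \<le> C * ln (ln x) \<longrightarrow> int p dvd Gcd D)"
proof -
  \<comment> \<open>28 = 2 * 7 * 2: the constant in the exponential of
    \<open>singular_series_nonaligned_le\<close>, with y \<ge> L / 7 and ln y \<ge> l / 2.\<close>
  define K where "K = 28 * real k * real (k + 1) ^ 2"
  \<comment> \<open>Makes 1/p \<ge> 2 K / l, twice the possible gain K / l, so a net factor exp(- K
    / l) is lost.\<close>
  define C where "C = 1 / (2 * K)"
  have K: "K > 0" using assms by (simp add: K_def)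
  have C: "C > 0" using K by (simp add: C_def)
  have "\<forall>\<^sub>F x::real in at_top. (1 - 1 / ln x) * (1 - 7 * real (k + 1) ^ 2 / ln x) > exp (- K / ln (ln x))"
    using K by real_asymp
  moreover have "\<forall>\<^sub>F x::real in at_top. 7 * real (k + 1) ^ 2 < ln x" by real_asymp
  moreover have "\<forall>\<^sub>F x::real in at_top. C * ln (ln x) \<le> ln x / 7" using C by real_asymp
  moreover have "\<forall>\<^sub>F x::real in at_top. ln (ln x) / 2 \<le> ln (ln x / 7)" by real_asymp
  moreover have "\<forall>\<^sub>F x::real in at_top. ln x > 14" by real_asymp
  moreover have "\<forall>\<^sub>F x::real in at_top. ln (ln x) > 1" by real_asymp
  moreover have "\<forall>\<^sub>F x::real in at_top. x > 1" by (rule eventually_gt_at_top)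
  ultimately have "\<forall>\<^sub>F x in at_top. \<forall>D. difference_champion k x D \<longrightarrow>
            (\<forall>p::nat. prime p \<and> real p \<le> C * ln (ln x) \<longrightarrow> int p dvd Gcd D)"
    using test_height_ge champion_nondegenerate[OF assms] test_series_ge_half[of k]
  proof eventually_elim
    case (elim x)
    define L where "L = ln x"
    define l where "l = ln L"
    define y where "y = test_height x"
    have L: "L > 14" "l > 1" and x: "x > 1" using elim by (auto simp: L_def l_def)
    have yL: "L / 7 \<le> real y" using elim by (simp add: L_def y_def)
    then have y2: "2 \<le> y" using L by linarith
    have "real (k + 1) \<le> real (k + 1) ^ 2" by (rule self_le_power) auto
    then have ky: "k + 1 \<le> y" using elim(2) yL L_def by linarith
    define E where "E = (\<Prod>p\<le>y. aligned_factor k p)"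
    have E: "E \<ge> 1" unfolding E_def by (intro prod_ge_1 aligned_factor_ge_1)
    define S' where "S' = test_series k x"
    have "E * (1 - real (k + 1) ^ 2 / real y) \<le> S'"
      using test_series_ge[of k x] ky by (simp add: E_def y_def S'_def)
    moreover have "E * (1 - 7 * real (k + 1) ^ 2 / L) \<le> E * (1 - real (k + 1) ^ 2 / real y)"
    proof (intro mult_left_mono diff_left_mono)
      have "real (k + 1) ^ 2 / real y \<le> real (k + 1) ^ 2 / (L / 7)"
        using yL L by (intro divide_left_mono) auto
      then show "real (k + 1) ^ 2 / real y \<le> 7 * real (k + 1) ^ 2 / L" by (simp add: mult.commute)
    qed (use E in auto)
    ultimately have S'E: "E * (1 - 7 * real (k + 1) ^ 2 / L) \<le> S'" by linarith
    show ?case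
    proof (intro allI impI)
      fix D and p :: nat
      assume D: "difference_champion k x D" and p: "prime p \<and> real p \<le> C * ln (ln x)"
      have ds: "difference_set k D" using D by (simp add: difference_champion_def)
      note max = difference_set_Max[OF ds assms(1)]
      show "int p dvd Gcd D"
      proof (rule ccontr)
        assume "\<not> int p dvd Gcd D"
        then obtain d where d: "d \<in> D" "\<not> int p dvd d - 0" by (rule not_dvd_Gcd_imp)
        \<comment> \<open>The missed prime must lie in the part of the product treated with aligned
          factors.\<close>
        have py: "p \<le> y" using p elim(3) yL by (simp add: L_def)
        have p0: "real p > 0" using p prime_gt_0_nat by auto
        have big: "k + 1 < tuple_count x D" and low: "S' * (1 - 1 / L) \<le> singular_series (insert 0 D)"
          using elim(9) D by (auto simp: S'_def L_def)
        have Mx: "real_of_int (Max D) \<le> x" using big by (intro tuple_count_pos_imp_Max_le) auto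
        have "2 * real k * real (k + 1) ^ 2 * ln (real_of_int (Max D)) / (real y * ln (real y))
               \<le> 2 * real k * real (k + 1) ^ 2 * L / (L / 7 * (l / 2))"
        proof (intro frac_le mult_left_mono mult_mono)
          show "ln (real_of_int (Max D)) \<le> L" using Mx max(4) x by (simp add: L_def)
          have "l / 2 \<le> ln (L / 7)" using elim(4) by (simp add: l_def L_def)
          also have "\<dots> \<le> ln (real y)" using yL L by (intro ln_mono) auto
          finally show "l / 2 \<le> ln (real y)" .
        qed (use yL L y2 in auto)
        also have "\<dots> = K / l" using L by (simp add: K_def)
        finally have ex: "2 * real k * real (k + 1) ^ 2 * ln (real_of_int (Max D)) / (real y * ln (real y)) \<le> K / l" .
        have "1 / (C * l) \<le> 1 / real p" using p p0 C L by (intro divide_left_mono) (auto simp: l_def L_def)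
        then have "1 - 1 / real p \<le> 1 - 2 * K / l" by (simp add: C_def)
        also have "\<dots> \<le> exp (- (2 * K / l))" using exp_ge_add_one_self[of "- (2 * K / l)"] by simp
        finally have pp: "1 - 1 / real p \<le> exp (- (2 * K / l))" .
        have "E * ((1 - 1 / L) * (1 - 7 * real (k + 1) ^ 2 / L)) = E * (1 - 7 * real (k + 1) ^ 2 / L) * (1 - 1 / L)"
          by simp
        also have "\<dots> \<le> S' * (1 - 1 / L)" using S'E L by (intro mult_right_mono) auto
        also have "\<dots> \<le> singular_series (insert 0 D)" by (rule low)
        also have "\<dots> \<le> (1 - 1 / real p) * E *
           exp (2 * real k * real (k + 1) ^ 2 * ln (real_of_int (Max D)) / (real y * ln (real y)))"
          unfolding E_def using max d p py y2
          by (intro singular_series_nonaligned_le[where a = d and b = 0]) auto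
        also have "\<dots> \<le> exp (- (2 * K / l)) * E * exp (K / l)"
          using pp ex E by (intro mult_mono) auto
        also have "\<dots> = E * exp (- K / l)" by (simp add: mult_ac exp_add[symmetric])
        finally have "(1 - 1 / L) * (1 - 7 * real (k + 1) ^ 2 / L) \<le> exp (- K / l)" using E by simp
        then show False using elim(1) by (simp add: L_def l_def)
      qed
    qed
  qed
  then show ?thesis using C by blast
qed

section \<open>The gcd of a champion is square-free\<close>

lemma Gcd_difference_set:
  assumes "difference_set k D" "k \<ge> 1"
  shows "0 < Gcd D" "Gcd D \<le> Max D"
proof -
  note max = difference_set_Max[OF assms]
  have dvd: "Gcd D dvd Max D" using max(3) by (rule Gcd_dvd)
  then have "Gcd D \<noteq> 0" using max(4) by (metis dvd_0_left_iff less_irrefl)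
  then show "0 < Gcd D" using Gcd_int_greater_eq_0[of D] by linarith
  show "Gcd D \<le> Max D" using dvd max(4) by (rule zdvd_imp_le)
qed

text \<open>Dilating D by a prime q that misses its gcd gains a share 1/q of the main term and
  shortens the integral by only about q d / ln^(k+1) x. A champion allows no net gain beyond the
  error, so d is at least of order x / q^2 with q \<le> 4 ln x.\<close>

lemma champion_Max_lower:
  assumes "k \<ge> 1" "uniform_tuple_conjecture k"
  shows "\<forall>\<^sub>F x in at_top. \<forall>D. difference_champion k x D \<longrightarrow>
           x / 256 \<le> real_of_int (Max D) * ln x ^ 2"
proof -
  have "\<forall>\<^sub>F x::real in at_top. ln x > 128" by real_asymp
  moreover have "\<forall>\<^sub>F x::real in at_top. x > 18" by (rule eventually_gt_at_top)
  ultimately show ?thesis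
    using tuple_count_lower[OF assms zero_less_one] tuple_count_upper[OF assms zero_less_one]
      champion_nondegenerate[OF assms] test_series_ge_half[of k] small_nondivisor_prime
      LI_ge_half[of "k + 1"] ln_scaled_power_ge[of "k + 1"]
  proof eventually_elim
    case (elim x)
    define L where "L = ln x"
    define u where "u = L ^ (k + 1)"
    define T where "T = LI (k + 1) x"
    have L: "L > 128" and x: "x > 18" using elim by (auto simp: L_def)
    have u: "u > 0" unfolding u_def using L by simp
    have u3: "L ^ (k + 3) = u * L ^ 2" by (simp add: u_def power_add power2_eq_square power3_eq_cube)
    have T: "x / (2 * u) \<le> T" using elim(8) by (simp add: T_def u_def L_def)
    define z where "z = x / (u * L ^ 2)"
    have z: "z > 0" using x u L by (simp add: z_def)
    have z3: "x / ln x ^ (k + 3) = z" unfolding z_def u3[symmetric] by (simp add: L_def)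
    show ?case
    proof (intro allI impI)
      fix D assume D: "difference_champion k x D"
      then have ds: "difference_set k D" by (simp add: difference_champion_def)
      note max = difference_set_Max[OF ds assms(1)]
      define S where "S = singular_series (insert 0 D)"
      define d where "d = real_of_int (Max D)"
      have big: "k + 1 < tuple_count x D" and low: "test_series k x * (1 - 1 / L) \<le> S"
        using elim(5) D by (auto simp: S_def L_def)
      have "1 / 2 * (1 / 2) \<le> test_series k x * (1 - 1 / L)"
        using elim(6) L by (intro mult_mono) (auto simp: field_simps)
      then have S: "1 / 4 \<le> S" using low by linarith
      have d: "0 < d" "d \<le> x"
        using max(4) tuple_count_pos_imp_Max_le[of x D] big by (auto simp: d_def)
      have up: "real (tuple_count x D) \<le> S * LI (k + 1) (max (x - d) (d / 8)) + 1 * (x / ln x ^ (k + 3))"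
        using elim(4) ds big by (auto simp: S_def d_def)
      have "S * LI (k + 1) (max (x - d) (d / 8)) \<le> S * T"
        unfolding T_def using S d by (intro mult_left_mono LI_mono) auto
      then have up: "real (tuple_count x D) \<le> S * T + z"
        using up unfolding z3 by linarith
      have g: "0 < Gcd D" "Gcd D \<le> Max D" using Gcd_difference_set[OF ds assms(1)] by auto
      then have "real (nat (Gcd D)) \<le> x" using d by (simp add: d_def)
      then obtain q where q: "prime q" "real q \<le> 4 * L" "\<not> q dvd nat (Gcd D)"
        using elim(7)[rule_format, of "nat (Gcd D)"] g by (auto simp: L_def)
      have "\<not> int q dvd Gcd D" using q(3) g by (simp add: nat_dvd_iff[symmetric] int_dvd_int_iff[symmetric])
      then obtain e where e: "e \<in> D" "\<not> int q dvd e - 0" by (rule not_dvd_Gcd_imp)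
      have q2: "real q \<ge> 2" using prime_ge_2_nat[OF q(1)] by simp
      show "x / 256 \<le> real_of_int (Max D) * ln x ^ 2"
      proof (cases "real q * d \<le> 8 / 9 * x")
        \<comment> \<open>Here q D may leave the range of the conjecture, but then d is already of
          order x / ln x.\<close>
        case False
        have "8 / 9 * x \<le> real q * d" using False by simp
        also have "\<dots> \<le> 4 * L * d" using q d by (intro mult_right_mono) auto
        finally have "2 / 9 * x \<le> d * L" by (simp add: mult_ac)
        also have "\<dots> \<le> d * L ^ 2" using d L by (intro mult_left_mono self_le_power) auto
        finally show ?thesis using x unfolding d_def L_def by linarith
      next
        case True
        define D' where "D' = (*) (int q) ` D"
        define S' where "S' = singular_series (insert 0 D')"
        define \<delta> where "\<delta> = T - LI (k + 1) (x - real q * d)"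
        have D': "difference_set k D'" unfolding D'_def using ds q2 by (intro difference_set_scale) auto
        have M': "real_of_int (Max D') = real q * d"
          unfolding D'_def d_def using max q2 by (subst Max_scale) auto
        have ins: "insert 0 D' = (*) (int q) ` insert 0 D" by (simp add: D'_def)
        have SS': "S \<le> (1 - 1 / real q) * S'"
          unfolding S_def S'_def ins using max e q
          by (intro singular_series_scale_nonaligned[where a = e and b = 0]) auto
        have "(1 - 1 / real q) * S' > 0" using SS' S by linarith
        then have S'0: "S' > 0" using q2 by (simp add: zero_less_mult_iff)
        \<comment> \<open>Multiplying by 1 + 1/q instead of dividing by 1 - 1/q avoids a quotient;
          (1 + 1/q)(1 - 1/q) \<le> 1.\<close>
        have "(1 + 1 / real q) * S \<le> (1 + 1 / real q) * ((1 - 1 / real q) * S')"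
          using SS' by (intro mult_left_mono) auto
        also have "\<dots> = (1 - 1 / real q ^ 2) * S'" by (simp add: algebra_simps power2_eq_square)
        also have "\<dots> \<le> 1 * S'" using S'0 by (intro mult_right_mono) auto
        finally have S'S: "(1 + 1 / real q) * S \<le> S'" by simp
        have "S' * LI (k + 1) (x - real q * d) - 1 * (x / ln x ^ (k + 3)) \<le> real (tuple_count x D')"
          using elim(3)[rule_format, of D'] D' S'0 M' True by (simp add: S'_def)
        also have "real (tuple_count x D') \<le> real (tuple_count x D)"
          using D D' by (simp add: difference_champion_def)
        finally have "S' * (T - \<delta>) \<le> S * T + 2 * z"
          using up unfolding z3 \<delta>_def by simp
        moreover have "(1 + 1 / real q) * S * (T - \<delta>) \<le> S' * (T - \<delta>)"
          using S'S LI_nonneg by (intro mult_right_mono) (auto simp: \<delta>_def)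
        \<comment> \<open>S \<ge> 1/4 makes the error a multiple of S, so that S can be
          cancelled.\<close>
        moreover have "2 * z \<le> S * (8 * z)" using S z by simp
        ultimately have "S * ((1 + 1 / real q) * (T - \<delta>)) \<le> S * (T + 8 * z)"
          by (simp add: algebra_simps)
        then have "(1 + 1 / real q) * (T - \<delta>) \<le> T + 8 * z" using S by simp
        moreover have "(1 + 1 / real q) * (T - \<delta>) = T - \<delta> + T / real q - \<delta> / real q"
          using q2 by (simp add: field_simps)
        ultimately have 1: "T / real q \<le> \<delta> + \<delta> / real q + 8 * z" by linarith
        have "\<delta> \<le> (x - (x - real q * d)) / ln (x - real q * d) ^ (k + 1)"
          unfolding \<delta>_def T_def using True x d q2 by (intro LI_diff_le) auto
        \<comment> \<open>In this case x - q d \<ge> x / 9, where the logarithm still has about its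
          full size.\<close>
        also have "\<dots> \<le> (real q * d) / ln (x / 9) ^ (k + 1)"
          using True x d q2 by (intro frac_le power_mono) auto
        also have "\<dots> \<le> (real q * d) / (u / 2)"
          using elim(9) u d q2 by (intro divide_left_mono) (auto simp: u_def L_def)
        finally have \<delta>: "\<delta> \<le> 2 * (real q * d) / u" by (simp add: mult_ac)
        have "\<delta> \<ge> 0" unfolding \<delta>_def T_def using LI_mono[of "x - real q * d" x "k + 1"] d q2 by simp
        then have "\<delta> / real q \<le> \<delta>" using q2 by (simp add: field_simps mult_le_cancel_left1)
        then have "x / (2 * u) / real q \<le> 2 * (2 * (real q * d) / u) + 8 * z"
          using 1 \<delta> divide_right_mono[OF T, of "real q"] q2 by linarith
        then have "u * (x / (2 * u) / real q) \<le> u * (2 * (2 * (real q * d) / u) + 8 * z)"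
          using u by (intro mult_left_mono) auto
        moreover have "u * (x / (2 * u) / real q) = x / 2 / real q" using u by simp
        moreover have "u * (2 * (2 * (real q * d) / u) + 8 * z) = 4 * real q * d + 8 * x / L ^ 2"
          using u by (simp add: z_def field_simps)
        ultimately have "x / 2 / real q \<le> 4 * real q * d + 8 * x / L ^ 2" by simp
        then have "x / 2 \<le> (4 * real q * d + 8 * x / L ^ 2) * real q" using q2 by (simp add: pos_divide_le_eq)
        also have "\<dots> = 4 * d * real q ^ 2 + 8 * x / L ^ 2 * real q"
          by (simp add: algebra_simps power2_eq_square)
        also have "\<dots> \<le> 4 * d * (4 * L) ^ 2 + 8 * x / L ^ 2 * (4 * L)"
          using q d x q2 by (intro add_mono mult_left_mono power_mono) auto
        also have "8 * x / L ^ 2 * (4 * L) = 32 * x / L" using L by (simp add: power2_eq_square)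
        \<comment> \<open>L > 128 lets half of the left side absorb the error, leaving x / 4 \<le>
          64 d L^2.\<close>
        also have "\<dots> \<le> x / 4" using L x by (simp add: field_simps)
        finally have "x / 4 \<le> 64 * (d * L ^ 2)" by (simp add: power2_eq_square)
        then show ?thesis unfolding d_def L_def by linarith
      qed
    qed
  qed
qed

text \<open>Dividing the champion by p lengthens the integral by at least order d without changing
  the singular series when p^2 divides the gcd. With d at least x / (256 ln^2 x), this gain has the
  size of x / ln^(k+3) x, so a small enough constant in the error yields a contradiction.\<close>

lemma champion_squarefree:
  assumes "k \<ge> 1" "uniform_tuple_conjecture k"
  shows "\<forall>\<^sub>F x in at_top. \<forall>D. difference_champion k x D \<longrightarrow> squarefree (Gcd D)"
proof -
  \<comment> \<open>The final comparison needs 64 \<eta> < 3 / 256; 1/10000 satisfies this.\<close>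
  define \<eta> :: real where "\<eta> = 1 / 10000"
  have \<eta>: "\<eta> > 0" by (simp add: \<eta>_def)
  have "\<forall>\<^sub>F x::real in at_top. ln x > 128" by real_asymp
  moreover have "\<forall>\<^sub>F x::real in at_top. x > 32" by (rule eventually_gt_at_top)
  ultimately show ?thesis
    using tuple_count_lower[OF assms \<eta>] tuple_count_upper[OF assms \<eta>]
      champion_nondegenerate[OF assms] test_series_ge_half[of k] champion_Max_lower[OF assms]
  proof eventually_elim
    case (elim x)
    define L where "L = ln x"
    define u where "u = L ^ (k + 1)"
    have L: "L > 128" and x: "x > 32" using elim by (auto simp: L_def)
    have u: "u > 0" unfolding u_def using L by simp
    have u3: "L ^ (k + 3) = u * L ^ 2" by (simp add: u_def power_add power2_eq_square power3_eq_cube)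
    define z where "z = x / (u * L ^ 2)"
    have z: "z > 0" using x u L by (simp add: z_def)
    have z3: "x / ln x ^ (k + 3) = z" unfolding z_def u3[symmetric] by (simp add: L_def)
    show ?case
    proof (intro allI impI)
      fix D assume D: "difference_champion k x D"
      then have ds: "difference_set k D" by (simp add: difference_champion_def)
      note max = difference_set_Max[OF ds assms(1)]
      define S where "S = singular_series (insert 0 D)"
      define d where "d = real_of_int (Max D)"
      have big: "k + 1 < tuple_count x D" and low: "test_series k x * (1 - 1 / L) \<le> S"
        using elim(5) D by (auto simp: S_def L_def)
      have "1 / 2 * (1 / 2) \<le> test_series k x * (1 - 1 / L)"
        using elim(6) L by (intro mult_mono) (auto simp: field_simps)
      then have S: "1 / 4 \<le> S" using low by linarith
      have d: "0 < d" "d \<le> x"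
        using max(4) tuple_count_pos_imp_Max_le[of x D] big by (auto simp: d_def)
      define w where "w = max (x - d) (d / 8)"
      have up: "real (tuple_count x D) \<le> S * LI (k + 1) w + \<eta> * z"
        using elim(4) ds big unfolding S_def d_def w_def z3 by blast
      show "squarefree (Gcd D)"
      proof (rule ccontr)
        assume "\<not> squarefree (Gcd D)"
        moreover have "Gcd D \<noteq> 0" using Gcd_difference_set[OF ds assms(1)] by linarith
        ultimately obtain p' :: int where p': "prime p'" "p' ^ 2 dvd Gcd D"
          using squarefree_factorial_semiring by metis
        define p where "p = nat p'"
        have pp: "int p = p'" "prime p" using p' prime_gt_0_int[of p'] by (auto simp: p_def)
        have p2: "real p \<ge> 2" using prime_ge_2_nat[OF pp(2)] by simp
        have dvd: "int p * int p dvd a" if "a \<in> D" for a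
          using dvd_trans[OF p'(2) Gcd_dvd[OF that]] by (simp add: pp power2_eq_square)
        define D' where "D' = (\<lambda>a. a div int p) ` D"
        have DD': "D = (*) (int p) ` D'"
        proof -
          have "int p * (a div int p) = a" if "a \<in> D" for a
            using dvd_mult_left[OF dvd[OF that]] by simp
          then show ?thesis by (simp add: D'_def image_image)
        qed
        \<comment> \<open>The second factor p of the square survives the division, so D' is still
          aligned at p.\<close>
        have dvd': "int p dvd b" if "b \<in> D'" for b
          using dvd[of "int p * b"] that p2 by (auto simp: DD')
        have D': "difference_set k D'"
        proof -
          have "finite D'" using max(1) by (simp add: D'_def)
          moreover have "card D = card D'"
            unfolding DD' using p2 by (intro card_image) (auto simp: inj_on_def)
          moreover have "0 < b" if "b \<in> D'" for b
          proof -
            have "0 < int p * b" using that ds by (auto simp: DD' difference_set_def)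
            then show ?thesis using p2 by (simp add: zero_less_mult_iff)
          qed
          ultimately show ?thesis using ds by (simp add: difference_set_def)
        qed
        note max' = difference_set_Max[OF D' assms(1)]
        define d' where "d' = real_of_int (Max D')"
        have "Max D = int p * Max D'" unfolding DD' using max' p2 by (intro Max_scale) auto
        then have dd': "d = real p * d'" by (simp add: d_def d'_def)
        have d'0: "d' > 0" using max'(4) by (simp add: d'_def)
        have "2 * d' \<le> real p * d'" using d'0 p2 by (intro mult_right_mono) auto
        then have d'2: "2 * d' \<le> d" using dd' by simp
        have ins: "insert 0 D = (*) (int p) ` insert 0 D'" by (simp add: DD')
        have S': "singular_series (insert 0 D') = S"
          unfolding S_def ins using dvd' pp by (subst singular_series_scale_aligned) auto
        have "S * LI (k + 1) (x - d') - \<eta> * z \<le> real (tuple_count x D')"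
          using elim(3)[rule_format, of D'] D' S S' d'2 d x unfolding z3 by (simp add: d'_def)
        also have "real (tuple_count x D') \<le> real (tuple_count x D)"
          using D D' by (simp add: difference_champion_def)
        finally have main: "S * (LI (k + 1) (x - d') - LI (k + 1) w) \<le> 2 * \<eta> * z"
          using up by (simp add: algebra_simps)
        \<comment> \<open>Here d' \<le> d / 2. If w = x - d, the gain is d - d' \<ge> d / 2; if w =
          d / 8, it is at least x - 5/8 d \<ge> 3/8 d because d \<le> x. For w \<ge> 2, either d
          \<ge> 16 or x - d > 16.\<close>
        have w: "2 \<le> w" "w + 3 / 8 * d \<le> x - d'"
          using d d'2 d'0 x unfolding w_def by linarith+
        have "3 / 8 * d / u \<le> (x - d' - w) / ln (x - d') ^ (k + 1)"
          unfolding u_def L_def using w d d'0 by (intro frac_le power_mono) auto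
        also have "\<dots> \<le> LI (k + 1) (x - d') - LI (k + 1) w" using w d by (intro LI_diff_ge) auto
        finally have "S * (3 / 8 * d / u) \<le> S * (LI (k + 1) (x - d') - LI (k + 1) w)"
          using S by (intro mult_left_mono) auto
        moreover note main
        moreover have "1 / 4 * (3 / 8 * d / u) \<le> S * (3 / 8 * d / u)"
          using S d u by (intro mult_right_mono) auto
        ultimately have "1 / 4 * (3 / 8 * d / u) \<le> 2 * \<eta> * z" by linarith
        then have "3 * (d * L ^ 2) \<le> 64 * \<eta> * x" using u L by (simp add: z_def field_simps)
        moreover have "x / 256 \<le> d * L ^ 2" using elim(7) D by (simp add: d_def L_def)
        ultimately show False using x by (simp add: \<eta>_def)
      qed
    qed
  qed
qed

theorem theorem1p3:
  fixes k :: nat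
  assumes "k \<ge> 1"
    and "uniform_tuple_conjecture k"
  shows "(\<exists>C>0. \<forall>\<^sub>F x in at_top. \<forall>D. difference_champion k x D \<longrightarrow>
            (\<forall>p::nat. prime p \<and> real p \<le> C * ln (ln x) \<longrightarrow> int p dvd Gcd D))
       \<and> (\<forall>\<^sub>F x in at_top. \<forall>D. difference_champion k x D \<longrightarrow> squarefree (Gcd D))"
  using champion_small_primes[OF assms] champion_squarefree[OF assms] by blast

end
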